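(* Let $k$ be a field of characteristic $\neq 2,3$. Then: (1) A Jacobi-Jordan (JJ) algebra over $k$ has an abelian derived algebra of codimension $1$ if and only if it is isomorphic to a JJ algebra of the form $V_{(f,v_0)}$, for some vector space $V$, $f\in\mathrm{End}_k(V)$ with $f^2=0$ and $v_0\in\mathrm{Ker}(f)$ such that $(f,v_0)\neq(0,0)$. (2) For any vector space $V$ there exists a bijection $$\mathbb{H}^2\bigl(k_0,V_0\bigr)\cong\bigsqcup_f\ \mathrm{Ker}(f)/\mathrm{Im}(f),$$ where the coproduct on the right hand side is the disjoint union of sets over all possible linear endomorphisms $f\in\mathrm{End}_k(V)$ with $f^2=0$. The bijection sends any element $\overline{v_0}\in\mathrm{Ker}(f)/\mathrm{Im}(f)$ to (the class of) the JJ algebra $V_{(f,v_0)}$.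
   Context: A JJ algebra is a $k$-vector space $J$ with a bilinear map $\cdot:J\times J\to J$ such that $a\cdot b=b\cdot a$ and $a\cdot(b\cdot c)+b\cdot(c\cdot a)+c\cdot(a\cdot b)=0$. The derived algebra $J'$ is the span of all products $a\cdot b$; an algebra is abelian if its multiplication is zero. $k_0$ and $V_0$ denote $k$ and $V$ with zero multiplication. For a vector space $V$, $f\in\mathrm{End}_k(V)$ with $f^2=0$ and $v_0\in\mathrm{Ker}(f)$, $V_{(f,v_0)}:=k\times V$ is the JJ algebra with multiplication $(p,x)\cdot(q,y):=(0,\ pq\,v_0+pf(y)+qf(x))$ for $p,q\in k$, $x,y\in V$. $\mathbb{H}^2(k_0,V_0)$ is the set of pairs $(\triangleright,\vartheta)$ of bilinear maps $\triangleright:k\times V\to V$, $\vartheta:k\times k\to V$ such that $k\times V$ with multiplication $(p,x)\bullet(q,y):=(0,\ \vartheta(p,q)+p\triangleright y+q\triangleright x)$ is a JJ algebra (the crossed product $k_0\#V_0$), modulo the equivalence relation: $(\triangleright,\vartheta)\approx_0(\triangleright',\vartheta')$ iff $\triangleright=\triangleright'$ and there is a linear map $r:k\to V$ with $\vartheta(p,q)=\vartheta'(p,q)+p\triangleright r(q)+q\triangleright r(p)$ for all $p,q\in k$. A class is identified with the corresponding crossed product; $V_{(f,v_0)}$ is the crossed product with $p\triangleright x=pf(x)$ and $\vartheta(p,q)=pq\,v_0$.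
   Formalization: (1) fails as stated (V=k², f=0, v₀≠0; or J=k₀). Proved instead: J non-abelian with J' abelian of codim 1 iff J≅V_(f,v₀), (f,v₀)≠0, V=kv₀+Im f; and J≅V_(f,v₀), (f,v₀)≠0, iff J is non-abelian with J' inside an abelian codim-1 subspace. *)

theory Defs
  imports "HOL-Algebra.Algebra"
begin

section \<open>Linear and bilinear maps\<close>

text \<open>
  A vector space over a field \<open>K\<close> is a \<open>module K V\<close> with \<open>field K\<close>; the fields \<open>mult\<close> and \<open>one\<close>
  of the record \<open>V\<close> are then irrelevant. For a \<open>k\<close>-algebra, the field \<open>mult\<close> is its (non-unital,
  non-associative) product, and \<open>one\<close> remains irrelevant.
\<close>

definition linear_map ::
  "('k, 'm) ring_scheme \<Rightarrow> ('k, 'a) module \<Rightarrow> ('k, 'b) module \<Rightarrow> ('a \<Rightarrow> 'b) \<Rightarrow> bool"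
  where "linear_map K U W h \<longleftrightarrow>
    h \<in> carrier U \<rightarrow> carrier W \<and>
    (\<forall>x\<in>carrier U. \<forall>y\<in>carrier U. h (x \<oplus>\<^bsub>U\<^esub> y) = h x \<oplus>\<^bsub>W\<^esub> h y) \<and>
    (\<forall>a\<in>carrier K. \<forall>x\<in>carrier U. h (a \<odot>\<^bsub>U\<^esub> x) = a \<odot>\<^bsub>W\<^esub> h x)"

definition bilinear_map ::
  "('k, 'm) ring_scheme \<Rightarrow> ('k, 'a) module \<Rightarrow> ('k, 'b) module \<Rightarrow> ('k, 'c) module \<Rightarrow>
    ('a \<Rightarrow> 'b \<Rightarrow> 'c) \<Rightarrow> bool"
  where "bilinear_map K U V W b \<longleftrightarrow>
    (\<forall>x\<in>carrier U. linear_map K V W (b x)) \<and> (\<forall>y\<in>carrier V. linear_map K U W (\<lambda>x. b x y))"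

text \<open>
  When linear or bilinear maps are collected into a set, they are taken to be extensional
  (\<open>undefined\<close> outside the carriers), so that equality is equality of maps on the carriers.
\<close>

definition Lin :: "('k, 'm) ring_scheme \<Rightarrow> ('k, 'a) module \<Rightarrow> ('k, 'b) module \<Rightarrow> ('a \<Rightarrow> 'b) set"
  where "Lin K U W = {h \<in> carrier U \<rightarrow>\<^sub>E carrier W. linear_map K U W h}"

definition Bilin ::
  "('k, 'm) ring_scheme \<Rightarrow> ('k, 'a) module \<Rightarrow> ('k, 'b) module \<Rightarrow> ('k, 'c) module \<Rightarrow>
    ('a \<Rightarrow> 'b \<Rightarrow> 'c) set"
  where "Bilin K U V W =
    {b \<in> carrier U \<rightarrow>\<^sub>E (carrier V \<rightarrow>\<^sub>E carrier W). bilinear_map K U V W b}"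

text \<open>The ring \<open>K\<close> as a module over itself; for a field, the underlying space of \<open>k\<^sub>0\<close>.\<close>

definition self_module :: "('k, 'm) ring_scheme \<Rightarrow> ('k, 'k) module"
  where "self_module K =
    \<lparr>carrier = carrier K, monoid.mult = (\<otimes>\<^bsub>K\<^esub>), monoid.one = \<one>\<^bsub>K\<^esub>,
     ring.zero = \<zero>\<^bsub>K\<^esub>, ring.add = (\<oplus>\<^bsub>K\<^esub>), smult = (\<otimes>\<^bsub>K\<^esub>)\<rparr>"


section \<open>Jacobi-Jordan algebras\<close>

locale jj_algebra = module K J
  for K :: "('k, 'm) ring_scheme" (structure) and J :: "('k, 'j) module" (structure) +
  assumes mult_bilinear: "bilinear_map K J J J (\<otimes>\<^bsub>J\<^esub>)"
    and mult_comm: "\<lbrakk>a \<in> carrier J; b \<in> carrier J\<rbrakk> \<Longrightarrow> a \<otimes>\<^bsub>J\<^esub> b = b \<otimes>\<^bsub>J\<^esub> a"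
    and jacobi: "\<lbrakk>a \<in> carrier J; b \<in> carrier J; c \<in> carrier J\<rbrakk> \<Longrightarrow>
      a \<otimes>\<^bsub>J\<^esub> (b \<otimes>\<^bsub>J\<^esub> c) \<oplus>\<^bsub>J\<^esub> b \<otimes>\<^bsub>J\<^esub> (c \<otimes>\<^bsub>J\<^esub> a) \<oplus>\<^bsub>J\<^esub> c \<otimes>\<^bsub>J\<^esub> (a \<otimes>\<^bsub>J\<^esub> b) = \<zero>\<^bsub>J\<^esub>"

definition jj_isomorphic ::
  "('k, 'm) ring_scheme \<Rightarrow> ('k, 'a) module \<Rightarrow> ('k, 'b) module \<Rightarrow> bool"
  where "jj_isomorphic K J L \<longleftrightarrow>
    (\<exists>h. linear_map K J L h \<and> bij_betw h (carrier J) (carrier L) \<and>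
      (\<forall>x\<in>carrier J. \<forall>y\<in>carrier J. h (x \<otimes>\<^bsub>J\<^esub> y) = h x \<otimes>\<^bsub>L\<^esub> h y))"

definition span :: "('k, 'm) ring_scheme \<Rightarrow> ('k, 'a) module \<Rightarrow> 'a set \<Rightarrow> 'a set"
  where "span K M S = \<Inter>{H. submodule H K M \<and> S \<subseteq> H}"

definition derived_algebra :: "('k, 'm) ring_scheme \<Rightarrow> ('k, 'a) module \<Rightarrow> 'a set"
  where "derived_algebra K J = span K J {a \<otimes>\<^bsub>J\<^esub> b | a b. a \<in> carrier J \<and> b \<in> carrier J}"

text \<open>A subspace \<open>H\<close> of \<open>J\<close> that is closed under products is the algebra \<open>J\<lparr>carrier := H\<rparr>\<close>.\<close>

definition abelian_algebra :: "('k, 'a) module \<Rightarrow> bool"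
  where "abelian_algebra A \<longleftrightarrow> (\<forall>x\<in>carrier A. \<forall>y\<in>carrier A. x \<otimes>\<^bsub>A\<^esub> y = \<zero>\<^bsub>A\<^esub>)"

text \<open>
  The subspace \<open>H\<close> has codimension \<open>n\<close> in \<open>M\<close>: the classes of some \<open>x 0, \<dots>, x (n - 1)\<close> form a
  basis of \<open>M / H\<close>, i.e. every element of \<open>M\<close> has unique coordinates modulo \<open>H\<close>.
\<close>

definition has_codim :: "('k, 'm) ring_scheme \<Rightarrow> ('k, 'a) module \<Rightarrow> 'a set \<Rightarrow> nat \<Rightarrow> bool"
  where "has_codim K M H n \<longleftrightarrow>
    (\<exists>x \<in> {..<n} \<rightarrow> carrier M. \<forall>z \<in> carrier M. \<exists>!c. c \<in> {..<n} \<rightarrow>\<^sub>E carrier K \<and>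
      z \<ominus>\<^bsub>M\<^esub> (\<Oplus>\<^bsub>M\<^esub>i\<in>{..<n}. c i \<odot>\<^bsub>M\<^esub> x i) \<in> H)"


section \<open>Crossed products of \<open>k\<^sub>0\<close> and \<open>V\<^sub>0\<close>\<close>

text \<open>
  In \<open>crossed_product K V act \<theta>\<close>, the map \<open>act\<close> is the action \<open>\<triangleright>\<close>. The value of \<open>one\<close> is arbitrary.
\<close>

definition crossed_product ::
  "('k, 'm) ring_scheme \<Rightarrow> ('k, 'v) module \<Rightarrow> ('k \<Rightarrow> 'v \<Rightarrow> 'v) \<Rightarrow> ('k \<Rightarrow> 'k \<Rightarrow> 'v) \<Rightarrow>
    ('k, 'k \<times> 'v) module"
  where "crossed_product K V act \<theta> =
    \<lparr>carrier = carrier K \<times> carrier V,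
     monoid.mult = (\<lambda>(p, x) (q, y). (\<zero>\<^bsub>K\<^esub>, \<theta> p q \<oplus>\<^bsub>V\<^esub> act p y \<oplus>\<^bsub>V\<^esub> act q x)),
     monoid.one = (\<zero>\<^bsub>K\<^esub>, \<zero>\<^bsub>V\<^esub>),
     ring.zero = (\<zero>\<^bsub>K\<^esub>, \<zero>\<^bsub>V\<^esub>),
     ring.add = (\<lambda>(p, x) (q, y). (p \<oplus>\<^bsub>K\<^esub> q, x \<oplus>\<^bsub>V\<^esub> y)),
     smult = (\<lambda>a (p, x). (a \<otimes>\<^bsub>K\<^esub> p, a \<odot>\<^bsub>V\<^esub> x))\<rparr>"

definition crossed_data ::
  "('k, 'm) ring_scheme \<Rightarrow> ('k, 'v) module \<Rightarrow> (('k \<Rightarrow> 'v \<Rightarrow> 'v) \<times> ('k \<Rightarrow> 'k \<Rightarrow> 'v)) set"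
  where "crossed_data K V =
    {(act, \<theta>). act \<in> Bilin K (self_module K) V V \<and>
       \<theta> \<in> Bilin K (self_module K) (self_module K) V \<and>
       jj_algebra K (crossed_product K V act \<theta>)}"

definition cohomologous ::
  "('k, 'm) ring_scheme \<Rightarrow> ('k, 'v) module \<Rightarrow>
    ((('k \<Rightarrow> 'v \<Rightarrow> 'v) \<times> ('k \<Rightarrow> 'k \<Rightarrow> 'v)) \<times> (('k \<Rightarrow> 'v \<Rightarrow> 'v) \<times> ('k \<Rightarrow> 'k \<Rightarrow> 'v))) set"
  where "cohomologous K V =
    {((act, \<theta>), (act', \<theta>')).
       (act, \<theta>) \<in> crossed_data K V \<and> (act', \<theta>') \<in> crossed_data K V \<and> act = act' \<and>
       (\<exists>r \<in> Lin K (self_module K) V. \<forall>p\<in>carrier K. \<forall>q\<in>carrier K.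
          \<theta> p q = \<theta>' p q \<oplus>\<^bsub>V\<^esub> act p (r q) \<oplus>\<^bsub>V\<^esub> act q (r p))}"

definition H2 ::
  "('k, 'm) ring_scheme \<Rightarrow> ('k, 'v) module \<Rightarrow>
    (('k \<Rightarrow> 'v \<Rightarrow> 'v) \<times> ('k \<Rightarrow> 'k \<Rightarrow> 'v)) set set"
  where "H2 K V = crossed_data K V // cohomologous K V"


section \<open>The algebras \<open>V\<^bsub>(f, v\<^sub>0)\<^esub>\<close>\<close>

definition sqzero_End :: "('k, 'm) ring_scheme \<Rightarrow> ('k, 'v) module \<Rightarrow> ('v \<Rightarrow> 'v) set"
  where "sqzero_End K V = {f \<in> Lin K V V. \<forall>x\<in>carrier V. f (f x) = \<zero>\<^bsub>V\<^esub>}"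

abbreviation Ker :: "('k, 'v) module \<Rightarrow> ('v \<Rightarrow> 'v) \<Rightarrow> 'v set"
  where "Ker V f \<equiv> a_kernel V V f"

definition pair_act :: "('k, 'm) ring_scheme \<Rightarrow> ('k, 'v) module \<Rightarrow> ('v \<Rightarrow> 'v) \<Rightarrow> 'k \<Rightarrow> 'v \<Rightarrow> 'v"
  where "pair_act K V f = (\<lambda>p\<in>carrier K. \<lambda>x\<in>carrier V. p \<odot>\<^bsub>V\<^esub> f x)"

definition pair_cocycle :: "('k, 'm) ring_scheme \<Rightarrow> ('k, 'v) module \<Rightarrow> 'v \<Rightarrow> 'k \<Rightarrow> 'k \<Rightarrow> 'v"
  where "pair_cocycle K V v\<^sub>0 = (\<lambda>p\<in>carrier K. \<lambda>q\<in>carrier K. (p \<otimes>\<^bsub>K\<^esub> q) \<odot>\<^bsub>V\<^esub> v\<^sub>0)"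

definition pair_algebra ::
  "('k, 'm) ring_scheme \<Rightarrow> ('k, 'v) module \<Rightarrow> ('v \<Rightarrow> 'v) \<Rightarrow> 'v \<Rightarrow> ('k, 'k \<times> 'v) module"
  where "pair_algebra K V f v\<^sub>0 = crossed_product K V (pair_act K V f) (pair_cocycle K V v\<^sub>0)"

lemma pair_algebra_mult:
  assumes "p \<in> carrier K" "q \<in> carrier K" "x \<in> carrier V" "y \<in> carrier V"
  shows "(p, x) \<otimes>\<^bsub>pair_algebra K V f v\<^sub>0\<^esub> (q, y) =
    (\<zero>\<^bsub>K\<^esub>, (p \<otimes>\<^bsub>K\<^esub> q) \<odot>\<^bsub>V\<^esub> v\<^sub>0 \<oplus>\<^bsub>V\<^esub> p \<odot>\<^bsub>V\<^esub> f y \<oplus>\<^bsub>V\<^esub> q \<odot>\<^bsub>V\<^esub> f x)"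
  using assms
  by (simp add: pair_algebra_def crossed_product_def pair_act_def pair_cocycle_def)

text \<open>The quotient \<open>Ker f / Im f\<close> as a set of cosets.\<close>

definition Ker_mod_Im :: "('k, 'v) module \<Rightarrow> ('v \<Rightarrow> 'v) \<Rightarrow> 'v set set"
  where "Ker_mod_Im V f = a_rcosets\<^bsub>V\<lparr>carrier := Ker V f\<rparr>\<^esub> (f ` carrier V)"

text \<open>The pairs \<open>(f, v\<^sub>0)\<close> that define an algebra \<open>V\<^bsub>(f, v\<^sub>0)\<^esub>\<close>, without the pair \<open>(0, 0)\<close>.\<close>

definition nonzero_pairs :: "('k, 'm) ring_scheme \<Rightarrow> ('k, 'v) module \<Rightarrow> (('v \<Rightarrow> 'v) \<times> 'v) set"
  where "nonzero_pairs K V =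
    {(f, v\<^sub>0). f \<in> sqzero_End K V \<and> v\<^sub>0 \<in> Ker V f \<and> (f, v\<^sub>0) \<noteq> (\<lambda>x\<in>carrier V. \<zero>\<^bsub>V\<^esub>, \<zero>\<^bsub>V\<^esub>)}"

end

theory Submission
  imports Defs
begin

text \<open>
  Let \<open>I\<close> be an abelian subspace of codimension 1 that contains \<open>J'\<close>, and let \<open>e \<notin> I\<close>. Then
  \<open>J = k e \<oplus> I\<close>, and the product is determined by \<open>f x = e x\<close> on \<open>I\<close> and by \<open>v\<^sub>0 = e e\<close>. The Jacobi
  identity at \<open>(e, e, x)\<close> reads \<open>2 f (f x) = 0\<close> and at \<open>(e, e, e)\<close> it reads \<open>3 f v\<^sub>0 = 0\<close>, which is where
  the characteristic enters. Conversely, in \<open>V\<^bsub>(f, v\<^sub>0)\<^esub>\<close> all triple products vanish, and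
  \<open>(1, 0) (a, x) = (0, a v\<^sub>0 + f x)\<close> shows that the derived algebra is \<open>0 \<times> (k v\<^sub>0 + Im f)\<close>.

  Since \<open>k\<close> is one-dimensional, the data \<open>(\<triangleright>, \<theta>)\<close> of a crossed product amount to \<open>f = 1 \<triangleright> _\<close> and
  \<open>v\<^sub>0 = \<theta> 1 1\<close>, and a linear \<open>r\<close> on \<open>k\<close> changes \<open>v\<^sub>0\<close> by \<open>2 f (r 1)\<close>, an arbitrary element of \<open>Im f\<close>.
\<close>

section \<open>Vector spaces\<close>

locale linear_space = module K V + K?: field K
  for K :: "('k, 'm) ring_scheme" (structure) and V :: "('k, 'v) module" (structure)
begin

abbreviation vec_zero ("\<zero>\<^sub>V") where "\<zero>\<^sub>V \<equiv> \<zero>\<^bsub>V\<^esub>"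
abbreviation vec_add (infixl "\<oplus>\<^sub>V" 65) where "x \<oplus>\<^sub>V y \<equiv> x \<oplus>\<^bsub>V\<^esub> y"
abbreviation vec_smult (infixr "\<odot>\<^sub>V" 75) where "a \<odot>\<^sub>V x \<equiv> a \<odot>\<^bsub>V\<^esub> x"

lemma smult_eq_zero:
  assumes "a \<in> carrier K" "a \<noteq> \<zero>" "x \<in> carrier V" "a \<odot>\<^sub>V x = \<zero>\<^sub>V"
  shows "x = \<zero>\<^sub>V"
proof -
  have "a \<in> Units K" using assms by (simp add: field_Units)
  then have "x = inv a \<odot>\<^sub>V (a \<odot>\<^sub>V x)"
    using assms(1-3) by (simp flip: smult_assoc1)
  also have "\<dots> = \<zero>\<^sub>V"
    using \<open>a \<in> Units K\<close> by (simp add: assms(4))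
  finally show ?thesis .
qed

text \<open>Characteristic different from 2 enters the Jacobi computations here: x + x is the
  multiple of x by 1 + 1, a scalar that can be cancelled. The next lemma does the same for
  3.\<close>

lemma double_eq_zero:
  assumes "add_pow K (2::nat) \<one> \<noteq> \<zero>" "x \<in> carrier V" "x \<oplus>\<^sub>V x = \<zero>\<^sub>V"
  shows "x = \<zero>\<^sub>V"
  using assms smult_eq_zero[of "\<one> \<oplus> \<one>" x]
  by (simp add: numeral_2_eq_2 smult_l_distr)

lemma triple_eq_zero:
  assumes "add_pow K (3::nat) \<one> \<noteq> \<zero>" "x \<in> carrier V" "x \<oplus>\<^sub>V x \<oplus>\<^sub>V x = \<zero>\<^sub>V"
  shows "x = \<zero>\<^sub>V"
  using assms smult_eq_zero[of "\<one> \<oplus> \<one> \<oplus> \<one>" x]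
  by (simp add: numeral_3_eq_3 smult_l_distr)

section \<open>Subspaces of codimension 1\<close>

lemma finsum_lessThan_1:
  "g 0 \<in> carrier V \<Longrightarrow> (\<Oplus>\<^bsub>V\<^esub>i\<in>{..<1::nat}. g i) = g 0"
  using M.finsum_insert[of "{}" 0 g] by (simp add: lessThan_Suc)

text \<open>For a single vector \<open>e\<close>, uniqueness of the coordinate modulo
  \<open>H\<close> amounts to \<open>e\<close> not being in \<open>H\<close>: if \<open>e\<close> is
  in \<open>H\<close>, every scalar is a coordinate of 0, and two distinct coordinates of one vector
  put a nonzero multiple of \<open>e\<close> into \<open>H\<close>.\<close>

lemma has_codim_1_iff:
  assumes H: "submodule H K V"
  shows "has_codim K V H 1 \<longleftrightarrow>
    (\<exists>e\<in>carrier V - H. \<forall>z\<in>carrier V. \<exists>a\<in>carrier K. z \<ominus>\<^bsub>V\<^esub> a \<odot>\<^sub>V e \<in> H)"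
proof
  note HE = submoduleE[OF H]
  assume "has_codim K V H 1"
  then obtain x where x: "x \<in> {..<1::nat} \<rightarrow> carrier V"
    and "\<forall>z\<in>carrier V. \<exists>!c. c \<in> {..<1} \<rightarrow>\<^sub>E carrier K \<and>
      z \<ominus>\<^bsub>V\<^esub> (\<Oplus>\<^bsub>V\<^esub>i\<in>{..<1}. c i \<odot>\<^sub>V x i) \<in> H"
    unfolding has_codim_def by (elim bexE) (rule that)
  note uniq = bspec[OF this(2)]
  have x0: "x 0 \<in> carrier V" using x by auto
  have sum: "(\<Oplus>\<^bsub>V\<^esub>i\<in>{..<1}. c i \<odot>\<^sub>V x i) = c 0 \<odot>\<^sub>V x 0" if "c \<in> {..<1} \<rightarrow>\<^sub>E carrier K" for c
  proof -
    have "c 0 \<in> carrier K" using that by (rule PiE_mem) simp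
    then have "c 0 \<odot>\<^sub>V x 0 \<in> carrier V" using x0 by (rule smult_closed)
    then show ?thesis by (rule finsum_lessThan_1[of "\<lambda>i. c i \<odot>\<^sub>V x i"])
  qed
  have "x 0 \<notin> H"
  proof
    assume xH: "x 0 \<in> H"
    \<comment> \<open>\<open>c a\<close> is the coordinate family with the single entry
      \<open>a\<close>. If \<open>x 0\<close> lies in \<open>H\<close>, both
      \<open>c \<zero>\<close> and \<open>c \<one>\<close> represent the zero vector, against
      uniqueness.\<close>
    define c where "c a = (\<lambda>i\<in>{..<1::nat}. a :: 'k)" for a
    have c: "c a \<in> {..<1} \<rightarrow>\<^sub>E carrier K" if "a \<in> carrier K" for a
      using that by (auto simp: c_def)
    have cH: "\<zero>\<^sub>V \<ominus>\<^bsub>V\<^esub> (\<Oplus>\<^bsub>V\<^esub>i\<in>{..<1}. c a i \<odot>\<^sub>V x i) \<in> H" if "a \<in> carrier K" for a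
      unfolding sum[OF c[OF that]] using HE(3)[OF HE(4)[OF that xH]] that x0
      by (simp add: c_def a_minus_def)
    have "c \<zero> = c \<one>"
      by (rule ex1E[OF uniq[OF M.zero_closed]]) (metis c cH R.zero_closed R.one_closed)
    then have "c \<zero> 0 = c \<one> 0" by simp
    then show False by (simp add: c_def)
  qed
  moreover have "\<exists>a\<in>carrier K. z \<ominus>\<^bsub>V\<^esub> a \<odot>\<^sub>V x 0 \<in> H" if z: "z \<in> carrier V" for z
  proof -
    obtain c where c: "c \<in> {..<1} \<rightarrow>\<^sub>E carrier K" "z \<ominus>\<^bsub>V\<^esub> (\<Oplus>\<^bsub>V\<^esub>i\<in>{..<1}. c i \<odot>\<^sub>V x i) \<in> H"
      using uniq[OF z] by blast
    have "c 0 \<in> carrier K" using c(1) by auto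
    with c(2) show ?thesis unfolding sum[OF c(1)] by blast
  qed
  ultimately show "\<exists>e\<in>carrier V - H. \<forall>z\<in>carrier V. \<exists>a\<in>carrier K. z \<ominus>\<^bsub>V\<^esub> a \<odot>\<^sub>V e \<in> H"
    using x0 by blast
next
  note HE = submoduleE[OF H]
  assume "\<exists>e\<in>carrier V - H. \<forall>z\<in>carrier V. \<exists>a\<in>carrier K. z \<ominus>\<^bsub>V\<^esub> a \<odot>\<^sub>V e \<in> H"
  then obtain e where e: "e \<in> carrier V" "e \<notin> H"
    and ex: "\<And>z. z \<in> carrier V \<Longrightarrow> \<exists>a\<in>carrier K. z \<ominus>\<^bsub>V\<^esub> a \<odot>\<^sub>V e \<in> H" by blast
  have sum: "(\<Oplus>\<^bsub>V\<^esub>i\<in>{..<1}. c i \<odot>\<^sub>V e) = c 0 \<odot>\<^sub>V e" if "c \<in> {..<1::nat} \<rightarrow>\<^sub>E carrier K" for c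
  proof -
    have "c 0 \<in> carrier K" using that by (rule PiE_mem) simp
    then have "c 0 \<odot>\<^sub>V e \<in> carrier V" using e(1) by (rule smult_closed)
    then show ?thesis by (rule finsum_lessThan_1[of "\<lambda>i. c i \<odot>\<^sub>V e"])
  qed
  \<comment> \<open>Subtracting the two representations cancels z and leaves (b - a) e in
    \<open>H\<close>; a nonzero b - a could be inverted and would put \<open>e\<close> itself into
    \<open>H\<close>.\<close>
  have unique: "a = b"
    if ab: "a \<in> carrier K" "b \<in> carrier K" and z: "z \<in> carrier V"
      and H': "z \<ominus>\<^bsub>V\<^esub> a \<odot>\<^sub>V e \<in> H" "z \<ominus>\<^bsub>V\<^esub> b \<odot>\<^sub>V e \<in> H" for a b z
  proof (rule ccontr)
    assume "a \<noteq> b"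
    then have u: "b \<ominus> a \<in> Units K" using ab by (simp add: field_Units)
    have "(z \<ominus>\<^bsub>V\<^esub> a \<odot>\<^sub>V e) \<oplus>\<^sub>V \<ominus>\<^bsub>V\<^esub> (z \<ominus>\<^bsub>V\<^esub> b \<odot>\<^sub>V e) \<in> H"
      using H' HE(3,5) by blast
    also have "(z \<ominus>\<^bsub>V\<^esub> a \<odot>\<^sub>V e) \<oplus>\<^sub>V \<ominus>\<^bsub>V\<^esub> (z \<ominus>\<^bsub>V\<^esub> b \<odot>\<^sub>V e) = b \<odot>\<^sub>V e \<ominus>\<^bsub>V\<^esub> a \<odot>\<^sub>V e"
    proof -
      have ae: "a \<odot>\<^sub>V e \<in> carrier V" "b \<odot>\<^sub>V e \<in> carrier V" using ab e by auto
      show ?thesis using z ae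
        by (simp add: a_minus_def M.minus_add M.a_ac M.r_neg2 M.r_neg1)
    qed
    also have "\<dots> = (b \<ominus> a) \<odot>\<^sub>V e"
      using ab e by (simp add: a_minus_def smult_l_distr smult_l_minus)
    finally have "inv (b \<ominus> a) \<odot>\<^sub>V ((b \<ominus> a) \<odot>\<^sub>V e) \<in> H"
      using u HE(4) by blast
    then show False using u e ab by (simp flip: smult_assoc1)
  qed
  show "has_codim K V H 1"
    unfolding has_codim_def
  proof (rule bexI[of _ "\<lambda>i. e"], rule ballI)
    fix z assume z: "z \<in> carrier V"
    obtain a where a: "a \<in> carrier K" "z \<ominus>\<^bsub>V\<^esub> a \<odot>\<^sub>V e \<in> H" using ex[OF z] by blast
    show "\<exists>!c. c \<in> {..<1} \<rightarrow>\<^sub>E carrier K \<and> z \<ominus>\<^bsub>V\<^esub> (\<Oplus>\<^bsub>V\<^esub>i\<in>{..<1::nat}. c i \<odot>\<^sub>V e) \<in> H"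
    proof (rule ex1I[of _ "\<lambda>i\<in>{..<1}. a"])
      show "(\<lambda>i\<in>{..<1}. a) \<in> {..<1} \<rightarrow>\<^sub>E carrier K \<and> z \<ominus>\<^bsub>V\<^esub> (\<Oplus>\<^bsub>V\<^esub>i\<in>{..<1::nat}. (\<lambda>i\<in>{..<1}. a) i \<odot>\<^sub>V e) \<in> H"
        using a sum[of "\<lambda>i\<in>{..<1}. a"] by auto
      fix c assume c: "c \<in> {..<1::nat} \<rightarrow>\<^sub>E carrier K \<and> z \<ominus>\<^bsub>V\<^esub> (\<Oplus>\<^bsub>V\<^esub>i\<in>{..<1}. c i \<odot>\<^sub>V e) \<in> H"
      then have "c 0 \<in> carrier K" "z \<ominus>\<^bsub>V\<^esub> c 0 \<odot>\<^sub>V e \<in> H" using sum[of c] by auto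
      then have "c 0 = a" using unique a z by blast
      then show "c = (\<lambda>i\<in>{..<1}. a)" using c by (auto simp: PiE_def extensional_def)
    qed
  qed (use e in auto)
qed

text \<open>Moving the multiple of \<open>e\<close> to the other side gives a decomposition into
  sums, a form to which a linear map can be applied directly.\<close>

lemma has_codim_1_iff_decomp:
  assumes H: "submodule H K V"
  shows "has_codim K V H 1 \<longleftrightarrow>
    (\<exists>e\<in>carrier V - H. \<forall>z\<in>carrier V. \<exists>a\<in>carrier K. \<exists>y\<in>H. z = y \<oplus>\<^sub>V a \<odot>\<^sub>V e)"
proof -
  have "z \<ominus>\<^bsub>V\<^esub> w \<in> H \<longleftrightarrow> (\<exists>y\<in>H. z = y \<oplus>\<^sub>V w)" if zw: "z \<in> carrier V" "w \<in> carrier V" for z w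
  proof
    assume "z \<ominus>\<^bsub>V\<^esub> w \<in> H"
    moreover have "z = (z \<ominus>\<^bsub>V\<^esub> w) \<oplus>\<^sub>V w"
      using zw by (simp add: a_minus_def M.a_assoc M.l_neg)
    ultimately show "\<exists>y\<in>H. z = y \<oplus>\<^sub>V w" by blast
  next
    assume "\<exists>y\<in>H. z = y \<oplus>\<^sub>V w"
    then obtain y where y: "y \<in> H" "z = y \<oplus>\<^sub>V w" by blast
    then have "y \<in> carrier V" using submoduleE(1)[OF H] by blast
    then have "z \<ominus>\<^bsub>V\<^esub> w = y" using y zw by (simp add: a_minus_def M.a_assoc M.r_neg)
    with y show "z \<ominus>\<^bsub>V\<^esub> w \<in> H" by simp
  qed
  then show ?thesis
    unfolding has_codim_1_iff[OF H] by (intro bex_cong ball_cong refl) auto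
qed

end

section \<open>Linear maps and their inverses\<close>

lemma linear_mapD:
  assumes "linear_map K U W h" "x \<in> carrier U"
  shows "h x \<in> carrier W"
    and "y \<in> carrier U \<Longrightarrow> h (x \<oplus>\<^bsub>U\<^esub> y) = h x \<oplus>\<^bsub>W\<^esub> h y"
    and "a \<in> carrier K \<Longrightarrow> h (a \<odot>\<^bsub>U\<^esub> x) = a \<odot>\<^bsub>W\<^esub> h x"
  using assms by (auto simp: linear_map_def)

lemma linear_map_zero:
  assumes "linear_map K U W h" "module K U" "module K W"
  shows "h \<zero>\<^bsub>U\<^esub> = \<zero>\<^bsub>W\<^esub>"
proof -
  interpret U: module K U by fact
  interpret W: module K W by fact
  show ?thesis
    using linear_mapD(1,3)[OF assms(1) U.zero_closed] U.R.zero_closed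
    by (metis U.smult_r_null W.smult_l_null)
qed

lemma linear_map_inv_into:
  assumes lin: "linear_map K U W h" and bij: "bij_betw h (carrier U) (carrier W)" and U: "module K U"
  shows "linear_map K W U (inv_into (carrier U) h)"
proof -
  interpret U: module K U by fact
  let ?g = "inv_into (carrier U) h"
  have g: "?g y \<in> carrier U" "h (?g y) = y" if "y \<in> carrier W" for y
    using that bij by (auto simp: bij_betw_def inv_into_into f_inv_into_f)
  \<comment> \<open>By injectivity, an identity for the inverse may be checked after applying
    \<open>h\<close>, where linearity is available.\<close>
  have gI: "?g y = x" if "x \<in> carrier U" "h x = y" for x y
    using that bij by (auto simp: bij_betw_def)
  show ?thesis
    unfolding linear_map_def
    by (auto intro!: gI simp: g linear_mapD[OF lin])
qed

section \<open>Crossed products\<close>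

lemma crossed_product_simps [simp]:
  "carrier (crossed_product K V act \<theta>) = carrier K \<times> carrier V"
  "\<zero>\<^bsub>crossed_product K V act \<theta>\<^esub> = (\<zero>\<^bsub>K\<^esub>, \<zero>\<^bsub>V\<^esub>)"
  "(p, x) \<oplus>\<^bsub>crossed_product K V act \<theta>\<^esub> (q, y) = (p \<oplus>\<^bsub>K\<^esub> q, x \<oplus>\<^bsub>V\<^esub> y)"
  "a \<odot>\<^bsub>crossed_product K V act \<theta>\<^esub> (p, x) = (a \<otimes>\<^bsub>K\<^esub> p, a \<odot>\<^bsub>V\<^esub> x)"
  "(p, x) \<otimes>\<^bsub>crossed_product K V act \<theta>\<^esub> (q, y) =
    (\<zero>\<^bsub>K\<^esub>, \<theta> p q \<oplus>\<^bsub>V\<^esub> act p y \<oplus>\<^bsub>V\<^esub> act q x)"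
  by (simp_all add: crossed_product_def)

lemma self_module_simps [simp]:
  "carrier (self_module K) = carrier K"
  "x \<oplus>\<^bsub>self_module K\<^esub> y = x \<oplus>\<^bsub>K\<^esub> y"
  "x \<odot>\<^bsub>self_module K\<^esub> y = x \<otimes>\<^bsub>K\<^esub> y"
  by (simp_all add: self_module_def)

text \<open>The vector space structure is that of the direct sum and does not involve the product,
  so the data \<open>act\<close> and \<open>\<theta>\<close> are arbitrary.\<close>

lemma module_crossed_product:
  assumes "module R M"
  shows "module R (crossed_product R M act \<theta>)"
proof -
  interpret module R M by fact
  show ?thesis
  proof (rule moduleI)
    show "cring R" by (rule R.is_cring)
    show "abelian_group (crossed_product R M act \<theta>)"
    proof (rule abelian_groupI)
      fix x assume "x \<in> carrier (crossed_product R M act \<theta>)"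
      then obtain p v where "x = (p, v)" "p \<in> carrier R" "v \<in> carrier M" by auto
      then show "\<exists>y\<in>carrier (crossed_product R M act \<theta>). y \<oplus>\<^bsub>crossed_product R M act \<theta>\<^esub> x = \<zero>\<^bsub>crossed_product R M act \<theta>\<^esub>"
        by (intro bexI[of _ "(\<ominus>\<^bsub>R\<^esub> p, \<ominus>\<^bsub>M\<^esub> v)"]) (simp_all add: R.l_neg M.l_neg)
    qed (auto simp: R.a_ac M.a_ac)
  qed (auto simp: smult_l_distr smult_r_distr smult_assoc1 R.l_distr R.r_distr R.m_assoc)
qed

lemma pair_algebra_simps [simp]:
  "carrier (pair_algebra K V f v\<^sub>0) = carrier K \<times> carrier V"
  "\<zero>\<^bsub>pair_algebra K V f v\<^sub>0\<^esub> = (\<zero>\<^bsub>K\<^esub>, \<zero>\<^bsub>V\<^esub>)"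
  "(p, x) \<oplus>\<^bsub>pair_algebra K V f v\<^sub>0\<^esub> (q, y) = (p \<oplus>\<^bsub>K\<^esub> q, x \<oplus>\<^bsub>V\<^esub> y)"
  "a \<odot>\<^bsub>pair_algebra K V f v\<^sub>0\<^esub> (p, x) = (a \<otimes>\<^bsub>K\<^esub> p, a \<odot>\<^bsub>V\<^esub> x)"
  by (simp_all add: pair_algebra_def)

lemma Ker_iff: "v \<in> Ker V f \<longleftrightarrow> v \<in> carrier V \<and> f v = \<zero>\<^bsub>V\<^esub>"
  by (simp add: a_kernel_def')

lemma sqzero_EndD:
  assumes "f \<in> sqzero_End K V"
  shows "f \<in> carrier V \<rightarrow>\<^sub>E carrier V" "linear_map K V V f"
    and "x \<in> carrier V \<Longrightarrow> f x \<in> carrier V"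
    and "x \<in> carrier V \<Longrightarrow> f (f x) = \<zero>\<^bsub>V\<^esub>"
  using assms by (auto simp: sqzero_End_def Lin_def)

section \<open>Crossed product data as pairs (f, v)\<close>

context linear_space
begin

lemma linear_map_self_module:
  assumes "linear_map K (self_module K) V h" "p \<in> carrier K"
  shows "h p = p \<odot>\<^sub>V h \<one>"
  using linear_mapD(3)[OF assms(1), of \<one> p] assms(2) by simp

lemma bilinear_pair_act:
  assumes f: "linear_map K V V f"
  shows "pair_act K V f \<in> Bilin K (self_module K) V V"
  by (auto simp: Bilin_def bilinear_map_def linear_map_def pair_act_def linear_mapD[OF f]
      smult_l_distr smult_r_distr m_comm simp flip: smult_assoc1)

lemma bilinear_pair_cocycle:
  assumes "v \<in> carrier V"
  shows "pair_cocycle K V v \<in> Bilin K (self_module K) (self_module K) V"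
  using assms
  by (auto simp: Bilin_def bilinear_map_def linear_map_def pair_cocycle_def
      smult_l_distr l_distr r_distr m_ac simp flip: smult_assoc1)

text \<open>Since p = p 1, linearity in the first argument fixes the action by its value at 1. Both
  sides are extensional, so they agree as functions and not only on the carriers.\<close>

lemma pair_act_one:
  assumes "act \<in> Bilin K (self_module K) V V"
  shows "pair_act K V (act \<one>) = act"
proof -
  have maps: "act \<in> carrier K \<rightarrow>\<^sub>E (carrier V \<rightarrow>\<^sub>E carrier V)"
    and lin: "x \<in> carrier V \<Longrightarrow> linear_map K (self_module K) V (\<lambda>p. act p x)" for x
    using assms by (auto simp: Bilin_def bilinear_map_def)
  show ?thesis
  proof (intro ext)
    fix p x
    show "pair_act K V (act \<one>) p x = act p x"
    proof (cases "p \<in> carrier K")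
      case True
      then have Fp: "act p \<in> carrier V \<rightarrow>\<^sub>E carrier V" by (rule PiE_mem[OF maps])
      show ?thesis
      proof (cases "x \<in> carrier V")
        case x: True
        with True show ?thesis
          using linear_map_self_module[OF lin[OF x] True] by (simp add: pair_act_def)
      next
        case False
        with True show ?thesis by (simp add: pair_act_def PiE_arb[OF Fp])
      qed
    next
      case False
      then show ?thesis by (simp add: pair_act_def PiE_arb[OF maps])
    qed
  qed
qed

text \<open>The same reduction, applied to each argument in turn: first p is pulled out of
  \<open>\<theta> p q\<close>, then q out of \<open>\<theta> \<one> q\<close>.\<close>

lemma pair_cocycle_one:
  assumes "\<theta> \<in> Bilin K (self_module K) (self_module K) V"
  shows "pair_cocycle K V (\<theta> \<one> \<one>) = \<theta>"
proof -
  have maps: "\<theta> \<in> carrier K \<rightarrow>\<^sub>E (carrier K \<rightarrow>\<^sub>E carrier V)"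
    and lin: "p \<in> carrier K \<Longrightarrow> linear_map K (self_module K) V (\<theta> p)"
      "q \<in> carrier K \<Longrightarrow> linear_map K (self_module K) V (\<lambda>p. \<theta> p q)" for p q
    using assms by (auto simp: Bilin_def bilinear_map_def)
  have closed: "\<theta> \<one> \<one> \<in> carrier V" using PiE_mem[OF PiE_mem[OF maps]] by simp
  have *: "\<theta> p q = (p \<otimes> q) \<odot>\<^sub>V \<theta> \<one> \<one>" if "p \<in> carrier K" "q \<in> carrier K" for p q
    using linear_map_self_module[OF lin(2) that(1), OF that(2)]
      linear_map_self_module[OF lin(1) that(2), OF one_closed] that closed
    by (simp add: smult_assoc1)
  show ?thesis
  proof (intro ext)
    fix p q
    show "pair_cocycle K V (\<theta> \<one> \<one>) p q = \<theta> p q"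
    proof (cases "p \<in> carrier K")
      case True
      then have Fp: "\<theta> p \<in> carrier K \<rightarrow>\<^sub>E carrier V" by (rule PiE_mem[OF maps])
      show ?thesis
      proof (cases "q \<in> carrier K")
        case x: True
        with True show ?thesis
          using *[OF True x] by (simp add: pair_cocycle_def)
      next
        case False
        with True show ?thesis by (simp add: pair_cocycle_def PiE_arb[OF Fp])
      qed
    next
      case False
      then show ?thesis by (simp add: pair_cocycle_def PiE_arb[OF maps])
    qed
  qed
qed

text \<open>A product in the pair algebra has three summands in \<open>V\<close>; this regrouping
  gives additivity of the product.\<close>

lemma add_interchange:
  assumes "a \<in> carrier V" "a' \<in> carrier V" "b \<in> carrier V" "b' \<in> carrier V"
    "c \<in> carrier V" "c' \<in> carrier V"
  shows "(a \<oplus>\<^sub>V a') \<oplus>\<^sub>V (b \<oplus>\<^sub>V b') \<oplus>\<^sub>V (c \<oplus>\<^sub>V c') = (a \<oplus>\<^sub>V b \<oplus>\<^sub>V c) \<oplus>\<^sub>V (a' \<oplus>\<^sub>V b' \<oplus>\<^sub>V c')"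
  using assms by (simp add: M.a_ac)

lemma jj_pair_algebra:
  assumes "f \<in> sqzero_End K V" "v \<in> Ker V f"
  shows "jj_algebra K (pair_algebra K V f v)"
proof -
  let ?P = "pair_algebra K V f v"
  interpret P: module K ?P
    unfolding pair_algebra_def by (rule module_crossed_product) (rule module_axioms)
  note lin = linear_mapD[OF sqzero_EndD(2)[OF assms(1)]]
  have v: "v \<in> carrier V" "f v = \<zero>\<^sub>V" using assms(2) by (auto simp: Ker_iff)
  have f0: "f \<zero>\<^sub>V = \<zero>\<^sub>V"
    using linear_map_zero[OF sqzero_EndD(2)[OF assms(1)]] module_axioms by blast
  have comm: "a \<otimes>\<^bsub>?P\<^esub> b = b \<otimes>\<^bsub>?P\<^esub> a" if ab: "a \<in> carrier ?P" "b \<in> carrier ?P" for a b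
  proof -
    obtain p x q y where *: "a = (p, x)" "b = (q, y)" "p \<in> carrier K" "x \<in> carrier V"
      "q \<in> carrier K" "y \<in> carrier V"
      using ab by auto
    then show ?thesis
      using M.a_assoc[of "(p \<otimes> q) \<odot>\<^sub>V v" "p \<odot>\<^sub>V f y" "q \<odot>\<^sub>V f x"]
        M.a_assoc[of "(p \<otimes> q) \<odot>\<^sub>V v" "q \<odot>\<^sub>V f x" "p \<odot>\<^sub>V f y"] v lin(1)
        M.a_comm[of "p \<odot>\<^sub>V f y" "q \<odot>\<^sub>V f x"] m_comm[of p q]
      by (simp add: pair_algebra_mult)
  qed
  have right: "linear_map K ?P ?P ((\<otimes>\<^bsub>?P\<^esub>) a)" if a: "a \<in> carrier ?P" for a
    unfolding linear_map_def
  proof (intro conjI ballI)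
    obtain p x where px: "a = (p, x)" "p \<in> carrier K" "x \<in> carrier V" using a by auto
    show "(\<otimes>\<^bsub>?P\<^esub>) a \<in> carrier ?P \<rightarrow> carrier ?P"
      using px v by (auto simp: pair_algebra_mult lin(1))
    fix b assume "b \<in> carrier ?P"
    then obtain q y where qy: "b = (q, y)" "q \<in> carrier K" "y \<in> carrier V" by auto
    show "a \<otimes>\<^bsub>?P\<^esub> (c \<odot>\<^bsub>?P\<^esub> b) = c \<odot>\<^bsub>?P\<^esub> (a \<otimes>\<^bsub>?P\<^esub> b)" if c: "c \<in> carrier K" for c
    proof -
      have "(p \<otimes> (c \<otimes> q)) \<odot>\<^sub>V v \<oplus>\<^sub>V p \<odot>\<^sub>V (c \<odot>\<^sub>V f y) \<oplus>\<^sub>V (c \<otimes> q) \<odot>\<^sub>V f x =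
          c \<odot>\<^sub>V ((p \<otimes> q) \<odot>\<^sub>V v \<oplus>\<^sub>V p \<odot>\<^sub>V f y \<oplus>\<^sub>V q \<odot>\<^sub>V f x)"
        using px qy c v lin(1) m_lcomm[of p c q] m_comm[of p c]
          smult_assoc1[of c "p \<otimes> q" v] smult_assoc1[of c q "f x"]
          smult_assoc1[of c p "f y"] smult_assoc1[of p c "f y"]
        by (simp add: smult_r_distr)
      then show ?thesis using px qy c v lin(1,3) by (simp add: pair_algebra_mult)
    qed
    fix c assume "c \<in> carrier ?P"
    then obtain r z where rz: "c = (r, z)" "r \<in> carrier K" "z \<in> carrier V" by auto
    have "(p \<otimes> (q \<oplus> r)) \<odot>\<^sub>V v \<oplus>\<^sub>V p \<odot>\<^sub>V (f y \<oplus>\<^sub>V f z) \<oplus>\<^sub>V (q \<oplus> r) \<odot>\<^sub>V f x =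
        ((p \<otimes> q) \<odot>\<^sub>V v \<oplus>\<^sub>V (p \<otimes> r) \<odot>\<^sub>V v) \<oplus>\<^sub>V (p \<odot>\<^sub>V f y \<oplus>\<^sub>V p \<odot>\<^sub>V f z) \<oplus>\<^sub>V (q \<odot>\<^sub>V f x \<oplus>\<^sub>V r \<odot>\<^sub>V f x)"
      using px qy rz v lin(1) by (simp add: r_distr smult_l_distr smult_r_distr)
    also have "\<dots> = ((p \<otimes> q) \<odot>\<^sub>V v \<oplus>\<^sub>V p \<odot>\<^sub>V f y \<oplus>\<^sub>V q \<odot>\<^sub>V f x) \<oplus>\<^sub>V
        ((p \<otimes> r) \<odot>\<^sub>V v \<oplus>\<^sub>V p \<odot>\<^sub>V f z \<oplus>\<^sub>V r \<odot>\<^sub>V f x)"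
      using px qy rz v by (intro add_interchange) (simp_all add: lin(1))
    finally show "a \<otimes>\<^bsub>?P\<^esub> (b \<oplus>\<^bsub>?P\<^esub> c) = a \<otimes>\<^bsub>?P\<^esub> b \<oplus>\<^bsub>?P\<^esub> a \<otimes>\<^bsub>?P\<^esub> c"
      using px qy rz v lin(1,2) by (simp add: pair_algebra_mult)
  qed
  have left: "linear_map K ?P ?P (\<lambda>x. x \<otimes>\<^bsub>?P\<^esub> a)" if "a \<in> carrier ?P" for a
  proof -
    have "x \<otimes>\<^bsub>?P\<^esub> a = a \<otimes>\<^bsub>?P\<^esub> x" if "x \<in> carrier ?P" for x
      using comm that \<open>a \<in> carrier ?P\<close> by blast
    with right[OF that] show ?thesis
      unfolding linear_map_def Pi_iff by (simp del: pair_algebra_simps)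
  qed
  \<comment> \<open>A product has the form (0, w) with w in k v + Im f. Multiplying it by (p, x)
    gives (0, p f w), and f w = 0 because f v = 0 and f f = 0. Each summand of the Jacobi identity
    is therefore zero.\<close>
  have triple: "a \<otimes>\<^bsub>?P\<^esub> (b \<otimes>\<^bsub>?P\<^esub> c) = \<zero>\<^bsub>?P\<^esub>"
    if "a \<in> carrier ?P" "b \<in> carrier ?P" "c \<in> carrier ?P" for a b c
    using that v f0 by (auto simp: pair_algebra_mult lin sqzero_EndD(4)[OF assms(1)])
  show ?thesis
  proof unfold_locales
    show "bilinear_map K ?P ?P ?P (\<otimes>\<^bsub>?P\<^esub>)"
      unfolding bilinear_map_def using left right by blast
  qed (use comm triple P.M.zero_closed in auto)
qed

text \<open>Converse of \<open>jj_pair_algebra\<close>. With e = (1, 0), the Jacobi identity at e,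
  e, (0, x) has the summands f (f x), f (f x), 0 in \<open>V\<close>, and at e, e, e it has f v
  three times.\<close>

lemma sqzero_if_jj_pair_algebra:
  assumes "jj_algebra K (pair_algebra K V f v)"
    and f: "f \<in> Lin K V V" and v: "v \<in> carrier V"
    and char: "add_pow K (2::nat) \<one> \<noteq> \<zero>" "add_pow K (3::nat) \<one> \<noteq> \<zero>"
  shows "f \<in> sqzero_End K V" "v \<in> Ker V f"
proof -
  let ?P = "pair_algebra K V f v"
  have lf: "linear_map K V V f" using f by (simp add: Lin_def)
  note lin = linear_mapD[OF lf]
  have f0: "f \<zero>\<^sub>V = \<zero>\<^sub>V" using linear_map_zero[OF lf] module_axioms by blast
  interpret P: jj_algebra K ?P by fact
  have "f (f x) = \<zero>\<^sub>V" if "x \<in> carrier V" for x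
  proof (rule double_eq_zero[OF char(1)])
    show "f (f x) \<oplus>\<^sub>V f (f x) = \<zero>\<^sub>V"
      using P.jacobi[of "(\<one>, \<zero>\<^sub>V)" "(\<one>, \<zero>\<^sub>V)" "(\<zero>, x)"] that v lin f0
      by (simp add: pair_algebra_mult)
  qed (simp_all add: that lin(1))
  then show "f \<in> sqzero_End K V" using f by (simp add: sqzero_End_def)
  have "f v = \<zero>\<^sub>V"
  proof (rule triple_eq_zero[OF char(2)])
    show "f v \<oplus>\<^sub>V f v \<oplus>\<^sub>V f v = \<zero>\<^sub>V"
      using P.jacobi[of "(\<one>, \<zero>\<^sub>V)" "(\<one>, \<zero>\<^sub>V)" "(\<one>, \<zero>\<^sub>V)"] v lin f0
      by (simp add: pair_algebra_mult)
  qed (simp_all add: v lin(1))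
  then show "v \<in> Ker V f" using v by (simp add: Ker_iff)
qed

text \<open>Evaluation at 1 turns bilinear data into a pair (f, v), and the Jacobi-Jordan condition
  on the crossed product becomes f f = 0 and f v = 0. This parametrisation reduces the computation
  of \<open>H2\<close> to pairs.\<close>

lemma crossed_data_eq:
  assumes char: "add_pow K (2::nat) \<one> \<noteq> \<zero>" "add_pow K (3::nat) \<one> \<noteq> \<zero>"
  shows "crossed_data K V =
    (\<lambda>(f, v). (pair_act K V f, pair_cocycle K V v)) ` (SIGMA f : sqzero_End K V. Ker V f)"
proof (intro subset_antisym subrelI)
  fix act \<theta> assume A: "(act, \<theta>) \<in> crossed_data K V"
  then have B: "act \<in> Bilin K (self_module K) V V" "\<theta> \<in> Bilin K (self_module K) (self_module K) V"
    and jj: "jj_algebra K (crossed_product K V act \<theta>)" by (auto simp: crossed_data_def)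
  have "act \<one> \<in> Lin K V V" "\<theta> \<one> \<one> \<in> carrier V"
    using B by (auto simp: Bilin_def bilinear_map_def Lin_def linear_map_def)
  moreover have "jj_algebra K (pair_algebra K V (act \<one>) (\<theta> \<one> \<one>))"
    unfolding pair_algebra_def pair_act_one[OF B(1)] pair_cocycle_one[OF B(2)] by (rule jj)
  ultimately have "act \<one> \<in> sqzero_End K V" "\<theta> \<one> \<one> \<in> Ker V (act \<one>)"
    using sqzero_if_jj_pair_algebra char by blast+
  moreover have "(act, \<theta>) = (pair_act K V (act \<one>), pair_cocycle K V (\<theta> \<one> \<one>))"
    using pair_act_one[OF B(1)] pair_cocycle_one[OF B(2)] by simp
  ultimately show "(act, \<theta>) \<in> (\<lambda>(f, v). (pair_act K V f, pair_cocycle K V v)) `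
      (SIGMA f : sqzero_End K V. Ker V f)"
    by (auto intro!: image_eqI[of _ _ "(act \<one>, \<theta> \<one> \<one>)"])
next
  fix act \<theta>
  assume "(act, \<theta>) \<in> (\<lambda>(f, v). (pair_act K V f, pair_cocycle K V v)) `
      (SIGMA f : sqzero_End K V. Ker V f)"
  then obtain f v where fv: "f \<in> sqzero_End K V" "v \<in> Ker V f"
    and eq: "act = pair_act K V f" "\<theta> = pair_cocycle K V v" by auto
  show "(act, \<theta>) \<in> crossed_data K V"
    using jj_pair_algebra[OF fv] bilinear_pair_act[OF sqzero_EndD(2)[OF fv(1)]]
      bilinear_pair_cocycle fv(2)
    by (simp add: crossed_data_def eq pair_algebra_def Ker_iff)
qed

end

section \<open>Cohomology\<close>

context linear_space
begin

lemma submodule_image: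
  assumes "linear_map K V V f"
  shows "submodule (f ` carrier V) K V"
proof -
  note lin = linear_mapD[OF assms]
  show ?thesis
  proof (rule submoduleI)
    show "\<zero>\<^sub>V \<in> f ` carrier V"
      using linear_map_zero[OF assms] module_axioms by (metis M.zero_closed imageI)
    fix x assume "x \<in> f ` carrier V"
    then obtain y where y: "y \<in> carrier V" "x = f y" by blast
    \<comment> \<open>\<open>linear_map\<close> speaks of sums and scalar multiples, so negation is
      treated as multiplication by -1.\<close>
    have "\<ominus>\<^bsub>V\<^esub> x = (\<ominus> \<one>) \<odot>\<^sub>V f y" using y lin(1) by (simp add: smult_l_minus)
    also have "\<dots> = f ((\<ominus> \<one>) \<odot>\<^sub>V y)" using y lin(3) by simp
    finally show "\<ominus>\<^bsub>V\<^esub> x \<in> f ` carrier V" using y by simp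
  qed (auto simp: lin simp flip: lin(2,3))
qed

lemma coset_eq_iff:
  assumes "submodule H K V" "v \<in> carrier V" "v' \<in> carrier V"
  shows "H +>\<^bsub>V\<^esub> v = H +>\<^bsub>V\<^esub> v' \<longleftrightarrow> (\<exists>h\<in>H. v = h \<oplus>\<^sub>V v')"
proof -
  have sub: "subgroup H (add_monoid V)" using assms(1) by (rule submodule.axioms)
  have self: "v \<in> H +>\<^bsub>V\<^esub> v"
    using subgroup.one_closed[OF sub] assms(2) by (force simp: a_r_coset_def')
  show ?thesis
  proof
    assume "H +>\<^bsub>V\<^esub> v = H +>\<^bsub>V\<^esub> v'"
    with self show "\<exists>h\<in>H. v = h \<oplus>\<^sub>V v'" by (auto simp: a_r_coset_def')
  next
    assume "\<exists>h\<in>H. v = h \<oplus>\<^sub>V v'"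
    then have "v \<in> H +>\<^bsub>V\<^esub> v'" by (auto simp: a_r_coset_def')
    then show "H +>\<^bsub>V\<^esub> v = H +>\<^bsub>V\<^esub> v'"
      using M.a_repr_independence[OF _ assms(3) sub] by simp
  qed
qed

text \<open>Equality of the actions is equality of the endomorphisms. In the condition on the
  cocycles every term is pq times a fixed vector, so its whole content is the case p = q =
  1.\<close>

lemma cohomologous_iff:
  assumes char: "add_pow K (2::nat) \<one> \<noteq> \<zero>" "add_pow K (3::nat) \<one> \<noteq> \<zero>"
    and f: "f \<in> sqzero_End K V" "v \<in> Ker V f" and f': "f' \<in> sqzero_End K V" "v' \<in> Ker V f'"
  shows "((pair_act K V f, pair_cocycle K V v), (pair_act K V f', pair_cocycle K V v'))
      \<in> cohomologous K V \<longleftrightarrow>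
    f = f' \<and> (f ` carrier V) +>\<^bsub>V\<^esub> v = (f' ` carrier V) +>\<^bsub>V\<^esub> v'" (is "?L \<longleftrightarrow> ?R")
proof -
  have v: "v \<in> carrier V" "v' \<in> carrier V" using f f' by (auto simp: Ker_iff)
  note lin = linear_mapD[OF sqzero_EndD(2)[OF f(1)]]
  \<comment> \<open>Elements of \<open>sqzero_End\<close> are extensional, so the action at 1
    returns the function \<open>g\<close> itself, also outside the carrier.\<close>
  have act_one_eq: "pair_act K V g \<one> = g" if "g \<in> sqzero_End K V" for g
    using sqzero_EndD(1,3)[OF that] by (auto simp: pair_act_def extensional_def PiE_def fun_eq_iff)
  have act: "pair_act K V f p x = p \<odot>\<^sub>V f x" if "p \<in> carrier K" "x \<in> carrier V" for p x
    using that by (simp add: pair_act_def)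
  have coc: "pair_cocycle K V w p q = (p \<otimes> q) \<odot>\<^sub>V w" if "p \<in> carrier K" "q \<in> carrier K" for w p q
    using that by (simp add: pair_cocycle_def)
  have data: "(pair_act K V f, pair_cocycle K V v) \<in> crossed_data K V"
    "(pair_act K V f', pair_cocycle K V v') \<in> crossed_data K V"
    unfolding crossed_data_eq[OF char] using f f' by auto
  show ?thesis
  proof
    assume ?L
    then obtain r where "pair_act K V f = pair_act K V f'"
      and r: "r \<in> Lin K (self_module K) V"
      and coh: "\<And>p q. \<lbrakk>p \<in> carrier K; q \<in> carrier K\<rbrakk> \<Longrightarrow> pair_cocycle K V v p q =
        pair_cocycle K V v' p q \<oplus>\<^sub>V pair_act K V f p (r q) \<oplus>\<^sub>V pair_act K V f q (r p)"
      by (auto simp: cohomologous_def)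
    then have eq: "f = f'" using act_one_eq f(1) f'(1) by metis
    have r1: "r \<one> \<in> carrier V" using r by (auto simp: Lin_def)
    \<comment> \<open>The cocycle condition at p = q = 1; the two equal terms combine to the image
      of r(1) + r(1), which witnesses the equality of cosets.\<close>
    have "v = v' \<oplus>\<^sub>V f (r \<one>) \<oplus>\<^sub>V f (r \<one>)"
      using coh[OF one_closed one_closed] v r1 lin by (simp add: act coc)
    also have "\<dots> = f (r \<one> \<oplus>\<^sub>V r \<one>) \<oplus>\<^sub>V v'" using v r1 lin by (simp add: M.a_ac)
    finally have "\<exists>h\<in>f ` carrier V. v = h \<oplus>\<^sub>V v'" using r1 by blast
    then show ?R
      using coset_eq_iff[OF submodule_image[OF sqzero_EndD(2)[OF f(1)]] v] eq by simp
  next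
    assume R: ?R
    then obtain w where w: "w \<in> carrier V" "v = f w \<oplus>\<^sub>V v'"
      using coset_eq_iff[OF submodule_image[OF sqzero_EndD(2)[OF f(1)]] v] by auto
    \<comment> \<open>The cosets provide v - v' = f w, whereas a linear \<open>r\<close> contributes
      f (r 1) twice. So r(1) has to be half of w, which exists because 2 is invertible.\<close>
    let ?two = "\<one> \<oplus> \<one>"
    have two: "?two \<in> Units K" using char(1) by (simp add: field_Units numeral_2_eq_2)
    define u where "u = inv ?two \<odot>\<^sub>V w"
    have u: "u \<in> carrier V" using two w by (simp add: u_def)
    have "u \<oplus>\<^sub>V u = ?two \<odot>\<^sub>V u" using u by (simp add: smult_l_distr)
    also have "\<dots> = w" using two w by (simp add: u_def flip: smult_assoc1)
    finally have fw: "f w = f u \<oplus>\<^sub>V f u" using lin u by metis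
    define r where "r = (\<lambda>p\<in>carrier K. p \<odot>\<^sub>V u)"
    have r: "r \<in> Lin K (self_module K) V"
      using u by (auto simp: r_def Lin_def linear_map_def smult_l_distr smult_assoc1)
    have "pair_cocycle K V v p q =
        pair_cocycle K V v' p q \<oplus>\<^sub>V pair_act K V f p (r q) \<oplus>\<^sub>V pair_act K V f q (r p)"
      if pq: "p \<in> carrier K" "q \<in> carrier K" for p q
    proof -
      have "(p \<otimes> q) \<odot>\<^sub>V (f u \<oplus>\<^sub>V f u \<oplus>\<^sub>V v') =
          (p \<otimes> q) \<odot>\<^sub>V v' \<oplus>\<^sub>V (p \<otimes> q) \<odot>\<^sub>V f u \<oplus>\<^sub>V (q \<otimes> p) \<odot>\<^sub>V f u"
        using pq u v lin(1) by (simp add: smult_r_distr M.a_ac m_comm)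
      then show ?thesis
        using pq u lin by (simp add: coc act r_def w(2) fw smult_assoc1)
    qed
    then show ?L using data r R by (auto simp: cohomologous_def)
  qed
qed

end

text \<open>Through the parametrisation \<open>g\<close>, the relation \<open>R\<close> is equality
  of the invariant \<open>\<pi>\<close>. Its classes are the images under \<open>g\<close> of the
  fibres of \<open>\<pi>\<close>, and a fibre corresponds to a value of
  \<open>\<pi>\<close>.\<close>

lemma quotient_image_bij:
  assumes A: "A = g ` P" and RA: "R \<subseteq> A \<times> A"
    and iff: "\<And>a b. \<lbrakk>a \<in> P; b \<in> P\<rbrakk> \<Longrightarrow> (g a, g b) \<in> R \<longleftrightarrow> \<pi> a = \<pi> b"
  shows "\<exists>\<Phi>. bij_betw \<Phi> (\<pi> ` P) (A // R) \<and> (\<forall>a\<in>P. \<Phi> (\<pi> a) = R `` {g a})"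
proof -
  have R: "R `` {g a} = {g b | b. b \<in> P \<and> \<pi> a = \<pi> b}" if "a \<in> P" for a
    using that RA iff unfolding A by blast
  \<comment> \<open>The chosen preimage is immaterial: by the description of the classes above,
    elements with the same value of \<open>\<pi>\<close> give the same class.\<close>
  define \<Phi> where "\<Phi> t = R `` {g (inv_into P \<pi> t)}" for t
  have \<Phi>: "\<Phi> (\<pi> a) = R `` {g a}" if "a \<in> P" for a
    using R[OF that] R[OF inv_into_into[of "\<pi> a" \<pi> P]] f_inv_into_f[of "\<pi> a" \<pi> P] that
    by (simp add: \<Phi>_def)
  have "bij_betw \<Phi> (\<pi> ` P) (A // R)"
  proof (intro bij_betw_imageI inj_onI)
    fix s t assume "s \<in> \<pi> ` P" "t \<in> \<pi> ` P" "\<Phi> s = \<Phi> t"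
    then obtain a b where ab: "a \<in> P" "b \<in> P" "s = \<pi> a" "t = \<pi> b" by auto
    then have "R `` {g a} = R `` {g b}" using \<open>\<Phi> s = \<Phi> t\<close> \<Phi> by simp
    moreover have "g b \<in> R `` {g b}" using iff ab by simp
    ultimately have "(g a, g b) \<in> R" by blast
    then show "s = t" using iff ab by simp
  next
    show "\<Phi> ` \<pi> ` P = A // R" unfolding quotient_def A using \<Phi> by auto
  qed
  with \<Phi> show ?thesis by blast
qed

text \<open>An instance of \<open>quotient_image_bij\<close>: pairs (f, v) parametrise the crossed
  data, and the invariant keeps f while replacing v by its coset modulo Im f.\<close>

lemma (in linear_space) H2_bij:
  assumes char: "add_pow K (2::nat) \<one> \<noteq> \<zero>" "add_pow K (3::nat) \<one> \<noteq> \<zero>"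
  shows "\<exists>\<Phi>. bij_betw \<Phi> (SIGMA f : sqzero_End K V. Ker_mod_Im V f) (H2 K V) \<and>
    (\<forall>f \<in> sqzero_End K V. \<forall>v\<^sub>0 \<in> Ker V f. \<Phi> (f, (f ` carrier V) +>\<^bsub>V\<^esub> v\<^sub>0) =
      cohomologous K V `` {(pair_act K V f, pair_cocycle K V v\<^sub>0)})"
proof -
  let ?P = "SIGMA f : sqzero_End K V. Ker V f"
  let ?g = "\<lambda>(f, v). (pair_act K V f, pair_cocycle K V v)"
  let ?\<pi> = "\<lambda>(f, v). (f, (f ` carrier V) +>\<^bsub>V\<^esub> v)"
  \<comment> \<open>Restricting the carrier to the kernel leaves the addition unchanged, so these
    cosets are the cosets in \<open>V\<close> of the elements of the kernel.\<close>
  have "Ker_mod_Im V f = (\<lambda>v. (f ` carrier V) +>\<^bsub>V\<^esub> v) ` Ker V f" for f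
    by (auto simp: Ker_mod_Im_def A_RCOSETS_def' a_r_coset_def')
  then have "?\<pi> ` ?P = (SIGMA f : sqzero_End K V. Ker_mod_Im V f)" by force
  moreover have "\<exists>\<Phi>. bij_betw \<Phi> (?\<pi> ` ?P) (crossed_data K V // cohomologous K V) \<and>
      (\<forall>a\<in>?P. \<Phi> (?\<pi> a) = cohomologous K V `` {?g a})"
  proof (rule quotient_image_bij)
    show "cohomologous K V \<subseteq> crossed_data K V \<times> crossed_data K V"
      by (auto simp: cohomologous_def)
    show "(?g a, ?g b) \<in> cohomologous K V \<longleftrightarrow> ?\<pi> a = ?\<pi> b" if "a \<in> ?P" "b \<in> ?P" for a b
      using that cohomologous_iff[OF char] by (auto split: prod.splits)
  qed (rule crossed_data_eq[OF char])
  ultimately show ?thesis unfolding H2_def by force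
qed

section \<open>Algebras with an abelian derived algebra\<close>

context jj_algebra
begin

lemma mult_closed: "\<lbrakk>a \<in> carrier J; b \<in> carrier J\<rbrakk> \<Longrightarrow> a \<otimes>\<^bsub>J\<^esub> b \<in> carrier J"
  using mult_bilinear by (auto simp: bilinear_map_def linear_map_def)

lemma mult_add_right: "\<lbrakk>a \<in> carrier J; b \<in> carrier J; c \<in> carrier J\<rbrakk> \<Longrightarrow>
    a \<otimes>\<^bsub>J\<^esub> (b \<oplus>\<^bsub>J\<^esub> c) = a \<otimes>\<^bsub>J\<^esub> b \<oplus>\<^bsub>J\<^esub> a \<otimes>\<^bsub>J\<^esub> c"
  using mult_bilinear by (auto simp: bilinear_map_def linear_map_def)

lemma mult_add_left: "\<lbrakk>a \<in> carrier J; b \<in> carrier J; c \<in> carrier J\<rbrakk> \<Longrightarrow>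
    (a \<oplus>\<^bsub>J\<^esub> b) \<otimes>\<^bsub>J\<^esub> c = a \<otimes>\<^bsub>J\<^esub> c \<oplus>\<^bsub>J\<^esub> b \<otimes>\<^bsub>J\<^esub> c"
  using mult_bilinear by (auto simp: bilinear_map_def linear_map_def)

lemma mult_smult_right: "\<lbrakk>a \<in> carrier J; b \<in> carrier J; p \<in> carrier K\<rbrakk> \<Longrightarrow>
    a \<otimes>\<^bsub>J\<^esub> (p \<odot>\<^bsub>J\<^esub> b) = p \<odot>\<^bsub>J\<^esub> (a \<otimes>\<^bsub>J\<^esub> b)"
  using mult_bilinear by (auto simp: bilinear_map_def linear_map_def)

lemma mult_smult_left: "\<lbrakk>a \<in> carrier J; b \<in> carrier J; p \<in> carrier K\<rbrakk> \<Longrightarrow>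
    (p \<odot>\<^bsub>J\<^esub> a) \<otimes>\<^bsub>J\<^esub> b = p \<odot>\<^bsub>J\<^esub> (a \<otimes>\<^bsub>J\<^esub> b)"
  using mult_bilinear by (auto simp: bilinear_map_def linear_map_def)

lemma mult_in_derived: "\<lbrakk>a \<in> carrier J; b \<in> carrier J\<rbrakk> \<Longrightarrow> a \<otimes>\<^bsub>J\<^esub> b \<in> derived_algebra K J"
  unfolding derived_algebra_def span_def by blast

lemma derived_subset:
  assumes "submodule H K J" "\<And>a b. \<lbrakk>a \<in> carrier J; b \<in> carrier J\<rbrakk> \<Longrightarrow> a \<otimes>\<^bsub>J\<^esub> b \<in> H"
  shows "derived_algebra K J \<subseteq> H"
  unfolding derived_algebra_def span_def using assms by blast

lemma submodule_derived: "submodule (derived_algebra K J) K J"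
proof -
  have zero: "\<zero>\<^bsub>J\<^esub> \<in> H" if "submodule H K J" for H
    using subgroup.one_closed[OF submodule.axioms(1)[OF that]] by simp
  show ?thesis
  proof (rule submoduleI)
    show "derived_algebra K J \<subseteq> carrier J"
      using derived_subset[OF carrier_is_submodule] mult_closed by blast
  qed (use zero submoduleE(3-5) in \<open>auto simp: derived_algebra_def span_def\<close>)
qed

end

section \<open>Algebras isomorphic to a pair algebra\<close>

lemma jj_isomorphic_sym:
  assumes "jj_algebra K L" "jj_isomorphic K L J"
  shows "jj_isomorphic K J L"
proof -
  interpret L: jj_algebra K L by fact
  obtain h where lin: "linear_map K L J h" and bij: "bij_betw h (carrier L) (carrier J)"
    and mult: "\<And>x y. \<lbrakk>x \<in> carrier L; y \<in> carrier L\<rbrakk> \<Longrightarrow> h (x \<otimes>\<^bsub>L\<^esub> y) = h x \<otimes>\<^bsub>J\<^esub> h y"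
    using assms(2) unfolding jj_isomorphic_def by blast
  let ?g = "inv_into (carrier L) h"
  have g: "?g y \<in> carrier L" "h (?g y) = y" if "y \<in> carrier J" for y
    using that bij by (auto simp: bij_betw_def inv_into_into f_inv_into_f)
  have gI: "?g y = x" if "x \<in> carrier L" "h x = y" for x y
    using that bij by (auto simp: bij_betw_def)
  have "?g (x \<otimes>\<^bsub>J\<^esub> y) = ?g x \<otimes>\<^bsub>L\<^esub> ?g y" if "x \<in> carrier J" "y \<in> carrier J" for x y
    using that by (intro gI) (simp_all add: g mult L.mult_closed)
  then show ?thesis
    unfolding jj_isomorphic_def
    using linear_map_inv_into[OF lin bij L.module_axioms] bij_betw_inv_into[OF bij] by blast
qed

text \<open>The isomorphism \<open>h\<close> serves as a system of coordinates (p, x) on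
  \<open>J\<close>. Statements about subspaces and codimension are thus proved for \<open>J\<close>
  directly and need no transport along an isomorphism.\<close>

locale jj_pair_iso = linear_space K V + J: jj_algebra K J
  for K :: "('k, 'm) ring_scheme" (structure) and V :: "('k, 'v) module" (structure)
    and J :: "('k, 'j) module" +
  fixes f :: "'v \<Rightarrow> 'v" and v :: 'v and h :: "'j \<Rightarrow> 'k \<times> 'v"
  assumes f: "f \<in> sqzero_End K V" and v: "v \<in> Ker V f"
    and h_linear: "linear_map K J (pair_algebra K V f v) h"
    and h_bij: "bij_betw h (carrier J) (carrier (pair_algebra K V f v))"
    and h_mult: "\<lbrakk>x \<in> carrier J; y \<in> carrier J\<rbrakk> \<Longrightarrow>
      h (x \<otimes>\<^bsub>J\<^esub> y) = h x \<otimes>\<^bsub>pair_algebra K V f v\<^esub> h y"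
begin

lemma linear_space_J: "linear_space K J"
  by unfold_locales

lemma f_closed: "x \<in> carrier V \<Longrightarrow> f x \<in> carrier V"
  and v_closed: "v \<in> carrier V"
  using sqzero_EndD(3)[OF f] v by (auto simp: Ker_iff)

lemma f_zero: "f \<zero>\<^sub>V = \<zero>\<^sub>V"
  using linear_map_zero[OF sqzero_EndD(2)[OF f]] module_axioms by blast

lemma h_inj: "\<lbrakk>x \<in> carrier J; y \<in> carrier J; h x = h y\<rbrakk> \<Longrightarrow> x = y"
  using h_bij by (auto simp: bij_betw_def inj_on_def)

lemma h_surj:
  assumes "p \<in> carrier K" "x \<in> carrier V"
  obtains z where "z \<in> carrier J" "h z = (p, x)"
proof -
  have "(p, x) \<in> h ` carrier J" using assms h_bij by (simp add: bij_betw_def)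
  then show thesis using that by (metis imageE)
qed

lemma h_cases:
  assumes "z \<in> carrier J"
  obtains p x where "h z = (p, x)" "p \<in> carrier K" "x \<in> carrier V"
  using linear_mapD(1)[OF h_linear assms] by (cases "h z") auto

lemma h_zero: "h \<zero>\<^bsub>J\<^esub> = (\<zero>, \<zero>\<^sub>V)"
proof -
  interpret P: jj_algebra K "pair_algebra K V f v" using jj_pair_algebra f v .
  show ?thesis using linear_map_zero[OF h_linear J.module_axioms P.module_axioms] by simp
qed

lemmas h_add = linear_mapD(2)[OF h_linear]
  and h_smult = linear_mapD(3)[OF h_linear]

text \<open>Used for two subspaces: \<open>T\<close> = V gives the abelian subspace of codimension
  1, and \<open>T\<close> = k v + Im f gives the derived algebra.\<close>

lemma submodule_vimage:
  assumes T: "submodule T K V"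
  shows "submodule {z \<in> carrier J. h z \<in> {\<zero>} \<times> T} K J"
proof -
  note TE = submoduleE[OF T]
  have T0: "\<zero>\<^sub>V \<in> T"
    using subgroup.one_closed[OF submodule.axioms(1)[OF T]] by simp
  have smult: "a \<odot>\<^bsub>J\<^esub> z \<in> {z \<in> carrier J. h z \<in> {\<zero>} \<times> T}"
    if "a \<in> carrier K" "z \<in> {z \<in> carrier J. h z \<in> {\<zero>} \<times> T}" for a z
    using that by (cases "h z") (auto simp: h_smult TE(4))
  have minus: "\<ominus>\<^bsub>J\<^esub> z = (\<ominus> \<one>) \<odot>\<^bsub>J\<^esub> z" if "z \<in> carrier J" for z
    using that by (simp add: J.smult_l_minus)
  show ?thesis
  proof (rule J.submoduleI)
    fix x assume x: "x \<in> {z \<in> carrier J. h z \<in> {\<zero>} \<times> T}"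
    then show "\<ominus>\<^bsub>J\<^esub> x \<in> {z \<in> carrier J. h z \<in> {\<zero>} \<times> T}"
      using smult[of "\<ominus> \<one>" x] minus by simp
    fix y assume "y \<in> {z \<in> carrier J. h z \<in> {\<zero>} \<times> T}"
    with x show "x \<oplus>\<^bsub>J\<^esub> y \<in> {z \<in> carrier J. h z \<in> {\<zero>} \<times> T}"
      by (cases "h x"; cases "h y") (auto simp: h_add TE(5))
  qed (use smult T0 in \<open>auto simp: h_zero\<close>)
qed

lemma h_mult_pair:
  assumes "x \<in> carrier J" "h x = (p, s)" "y \<in> carrier J" "h y = (q, t)"
  shows "h (x \<otimes>\<^bsub>J\<^esub> y) = (\<zero>, (p \<otimes> q) \<odot>\<^sub>V v \<oplus>\<^sub>V p \<odot>\<^sub>V f t \<oplus>\<^sub>V q \<odot>\<^sub>V f s)"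
    and "p \<in> carrier K" "q \<in> carrier K" "s \<in> carrier V" "t \<in> carrier V"
proof -
  show *: "p \<in> carrier K" "q \<in> carrier K" "s \<in> carrier V" "t \<in> carrier V"
    using assms linear_mapD(1)[OF h_linear] by force+
  show "h (x \<otimes>\<^bsub>J\<^esub> y) = (\<zero>, (p \<otimes> q) \<odot>\<^sub>V v \<oplus>\<^sub>V p \<odot>\<^sub>V f t \<oplus>\<^sub>V q \<odot>\<^sub>V f s)"
    using h_mult[OF assms(1,3)] assms(2,4) * by (simp add: pair_algebra_mult)
qed

text \<open>If e has coordinates (1, 0) and z has coordinates (0, x), then e e and e z have
  coordinates (0, v) and (0, f x). Vanishing of the product therefore forces both parts of the pair
  to vanish.\<close>

lemma abelian_iff:
  "abelian_algebra J \<longleftrightarrow> (f, v) = (\<lambda>x\<in>carrier V. \<zero>\<^sub>V, \<zero>\<^sub>V)"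
proof
  assume ab: "abelian_algebra J"
  obtain e where e: "e \<in> carrier J" "h e = (\<one>, \<zero>\<^sub>V)"
    using h_surj[OF one_closed M.zero_closed] .
  have "h (e \<otimes>\<^bsub>J\<^esub> e) = (\<zero>, v)"
    using h_mult_pair(1)[OF e e] by (simp add: f_zero v_closed)
  then have "v = \<zero>\<^sub>V" using ab e by (simp add: abelian_algebra_def h_zero)
  moreover have "f x = \<zero>\<^sub>V" if x: "x \<in> carrier V" for x
  proof -
    obtain z where z: "z \<in> carrier J" "h z = (\<zero>, x)" using h_surj[OF R.zero_closed x] .
    have "h (e \<otimes>\<^bsub>J\<^esub> z) = (\<zero>, f x)"
      using h_mult_pair(1)[OF e z] x by (simp add: f_zero v_closed f_closed)
    then show "f x = \<zero>\<^sub>V" using ab e z by (simp add: abelian_algebra_def h_zero)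
  qed
  then have "f = (\<lambda>x\<in>carrier V. \<zero>\<^sub>V)"
    using sqzero_EndD(1)[OF f] by (auto simp: PiE_def extensional_def)
  ultimately show "(f, v) = (\<lambda>x\<in>carrier V. \<zero>\<^sub>V, \<zero>\<^sub>V)" by simp
next
  assume fv: "(f, v) = (\<lambda>x\<in>carrier V. \<zero>\<^sub>V, \<zero>\<^sub>V)"
  show "abelian_algebra J"
    unfolding abelian_algebra_def
  proof (intro ballI)
    fix x y assume xy: "x \<in> carrier J" "y \<in> carrier J"
    obtain p s where s: "h x = (p, s)" using h_cases[OF xy(1)] .
    obtain q t where t: "h y = (q, t)" using h_cases[OF xy(2)] .
    have "h (x \<otimes>\<^bsub>J\<^esub> y) = h \<zero>\<^bsub>J\<^esub>"
      using h_mult_pair[OF xy(1) s xy(2) t] fv by (simp add: h_zero)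
    then show "x \<otimes>\<^bsub>J\<^esub> y = \<zero>\<^bsub>J\<^esub>" by (intro h_inj J.mult_closed J.M.zero_closed xy)
  qed
qed

lemma submodule_sum:
  "submodule {a \<odot>\<^sub>V v \<oplus>\<^sub>V f x | a x. a \<in> carrier K \<and> x \<in> carrier V} K V" (is "submodule ?S K V")
proof -
  note lin = linear_mapD[OF sqzero_EndD(2)[OF f]]
  have smult: "c \<odot>\<^sub>V y \<in> ?S" if c: "c \<in> carrier K" and y: "y \<in> ?S" for c y
  proof -
    obtain a x where ax: "a \<in> carrier K" "x \<in> carrier V" "y = a \<odot>\<^sub>V v \<oplus>\<^sub>V f x" using y by blast
    have "c \<odot>\<^sub>V y = (c \<otimes> a) \<odot>\<^sub>V v \<oplus>\<^sub>V f (c \<odot>\<^sub>V x)"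
      using ax c by (simp add: smult_r_distr smult_assoc1 lin(3) v_closed f_closed)
    moreover have "c \<otimes> a \<in> carrier K" "c \<odot>\<^sub>V x \<in> carrier V" using c ax by auto
    ultimately show ?thesis by blast
  qed
  have S: "?S \<subseteq> carrier V" by (auto simp: v_closed f_closed)
  show ?thesis
  proof (rule submoduleI)
    have "\<zero>\<^sub>V = \<zero> \<odot>\<^sub>V v \<oplus>\<^sub>V f \<zero>\<^sub>V" by (simp add: v_closed f_zero)
    then show "\<zero>\<^sub>V \<in> ?S" using R.zero_closed M.zero_closed by blast
  next
    fix y assume y: "y \<in> ?S"
    with S have "y \<in> carrier V" by blast
    then have "\<ominus>\<^bsub>V\<^esub> y = (\<ominus> \<one>) \<odot>\<^sub>V y" by (simp add: smult_l_minus)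
    then show "\<ominus>\<^bsub>V\<^esub> y \<in> ?S" using smult[OF _ y, of "\<ominus> \<one>"] by simp
  next
    fix y z assume "y \<in> ?S" "z \<in> ?S"
    then obtain a x b w where *: "a \<in> carrier K" "x \<in> carrier V" "y = a \<odot>\<^sub>V v \<oplus>\<^sub>V f x"
      "b \<in> carrier K" "w \<in> carrier V" "z = b \<odot>\<^sub>V v \<oplus>\<^sub>V f w" by blast
    then have "y \<oplus>\<^sub>V z = (a \<oplus> b) \<odot>\<^sub>V v \<oplus>\<^sub>V f (x \<oplus>\<^sub>V w)"
      by (simp add: smult_l_distr lin(2) v_closed f_closed M.a_ac)
    moreover have "a \<oplus> b \<in> carrier K" "x \<oplus>\<^sub>V w \<in> carrier V" using * by auto
    ultimately show "y \<oplus>\<^sub>V z \<in> ?S" by blast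
  qed (use S smult in auto)
qed

text \<open>The product of (p, s) and (q, t) has the \<open>V\<close>-part pq v + f (p t + q s).
  Conversely, (1, 0) (a, x) = (0, a v + f x), so every element of the right hand side is a single
  product.\<close>

lemma derived_eq:
  "derived_algebra K J =
    {z \<in> carrier J. h z \<in> {\<zero>} \<times> {a \<odot>\<^sub>V v \<oplus>\<^sub>V f x | a x. a \<in> carrier K \<and> x \<in> carrier V}}"
  (is "_ = {z \<in> carrier J. h z \<in> {\<zero>} \<times> ?S}")
proof
  show "derived_algebra K J \<subseteq> {z \<in> carrier J. h z \<in> {\<zero>} \<times> ?S}"
  proof (rule J.derived_subset[OF submodule_vimage[OF submodule_sum]])
    fix x y assume xy: "x \<in> carrier J" "y \<in> carrier J"
    obtain p s where s: "h x = (p, s)" using h_cases[OF xy(1)] .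
    obtain q t where t: "h y = (q, t)" using h_cases[OF xy(2)] .
    note hm = h_mult_pair[OF xy(1) s xy(2) t]
    note lin = linear_mapD[OF sqzero_EndD(2)[OF f]]
    have eq: "h (x \<otimes>\<^bsub>J\<^esub> y) = (\<zero>, (p \<otimes> q) \<odot>\<^sub>V v \<oplus>\<^sub>V f (p \<odot>\<^sub>V t \<oplus>\<^sub>V q \<odot>\<^sub>V s))"
      using hm by (simp add: lin(2,3) v_closed f_closed M.a_assoc)
    have "p \<otimes> q \<in> carrier K" "p \<odot>\<^sub>V t \<oplus>\<^sub>V q \<odot>\<^sub>V s \<in> carrier V" using hm by auto
    then have "(p \<otimes> q) \<odot>\<^sub>V v \<oplus>\<^sub>V f (p \<odot>\<^sub>V t \<oplus>\<^sub>V q \<odot>\<^sub>V s) \<in> ?S" by blast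
    then have "h (x \<otimes>\<^bsub>J\<^esub> y) \<in> {\<zero>} \<times> ?S" unfolding eq by (rule SigmaI[OF singletonI])
    then show "x \<otimes>\<^bsub>J\<^esub> y \<in> {z \<in> carrier J. h z \<in> {\<zero>} \<times> ?S}"
      using J.mult_closed[OF xy] by (intro CollectI conjI)
  qed
  show "{z \<in> carrier J. h z \<in> {\<zero>} \<times> ?S} \<subseteq> derived_algebra K J"
  proof
    fix z assume "z \<in> {z \<in> carrier J. h z \<in> {\<zero>} \<times> ?S}"
    then obtain a x where z: "z \<in> carrier J" "h z = (\<zero>, a \<odot>\<^sub>V v \<oplus>\<^sub>V f x)"
      and ax: "a \<in> carrier K" "x \<in> carrier V" by blast
    obtain e where e: "e \<in> carrier J" "h e = (\<one>, \<zero>\<^sub>V)"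
      using h_surj[OF one_closed M.zero_closed] .
    obtain y where y: "y \<in> carrier J" "h y = (a, x)" using h_surj[OF ax] .
    have "h (e \<otimes>\<^bsub>J\<^esub> y) = h z"
      using h_mult_pair(1)[OF e y] z ax by (simp add: v_closed f_closed f_zero)
    then have "e \<otimes>\<^bsub>J\<^esub> y = z" by (intro h_inj J.mult_closed z e y)
    then show "z \<in> derived_algebra K J" using J.mult_in_derived e y by blast
  qed
qed

text \<open>Each summand of the product formula carries the scalar coordinate of one of the factors,
  and here these are zero.\<close>

lemma vimage_abelian:
  "abelian_algebra (J\<lparr>carrier := {z \<in> carrier J. h z \<in> {\<zero>} \<times> carrier V}\<rparr>)"
proof -
  have "x \<otimes>\<^bsub>J\<^esub> y = \<zero>\<^bsub>J\<^esub>"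
    if xy: "x \<in> carrier J" "y \<in> carrier J" and h: "h x = (\<zero>, s)" "h y = (\<zero>, t)" for x y s t
  proof -
    have "h (x \<otimes>\<^bsub>J\<^esub> y) = h \<zero>\<^bsub>J\<^esub>"
      using h_mult_pair[OF xy(1) h(1) xy(2) h(2)] by (simp add: h_zero v_closed f_closed)
    then show ?thesis by (intro h_inj J.mult_closed J.M.zero_closed xy)
  qed
  then show ?thesis by (auto simp: abelian_algebra_def)
qed

lemma derived_subset_vimage:
  "derived_algebra K J \<subseteq> {z \<in> carrier J. h z \<in> {\<zero>} \<times> carrier V}"
  unfolding derived_eq by (auto simp: v_closed f_closed)

lemma derived_abelian: "abelian_algebra (J\<lparr>carrier := derived_algebra K J\<rparr>)"
  using vimage_abelian derived_subset_vimage unfolding abelian_algebra_def by auto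

lemma vimage_codim:
  "has_codim K J {z \<in> carrier J. h z \<in> {\<zero>} \<times> carrier V} 1" (is "has_codim K J ?I 1")
proof -
  obtain e where e: "e \<in> carrier J" "h e = (\<one>, \<zero>\<^sub>V)"
    using h_surj[OF one_closed M.zero_closed] .
  have "\<exists>a\<in>carrier K. \<exists>y\<in>?I. z = y \<oplus>\<^bsub>J\<^esub> a \<odot>\<^bsub>J\<^esub> e" if z: "z \<in> carrier J" for z
  proof -
    obtain p x where px: "h z = (p, x)" "p \<in> carrier K" "x \<in> carrier V" using h_cases[OF z] .
    obtain y where y: "y \<in> carrier J" "h y = (\<zero>, x)" using h_surj[OF R.zero_closed px(3)] .
    have "h z = h (y \<oplus>\<^bsub>J\<^esub> p \<odot>\<^bsub>J\<^esub> e)" using px y e by (simp add: h_add h_smult)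
    then have "z = y \<oplus>\<^bsub>J\<^esub> p \<odot>\<^bsub>J\<^esub> e" using z px y e by (intro h_inj) auto
    moreover have "y \<in> ?I" using y px by simp
    ultimately show ?thesis using px(2) by (intro bexI[of _ p] bexI[of _ y])
  qed
  moreover have "e \<in> carrier J - ?I" using e by simp
  ultimately show ?thesis
    unfolding linear_space.has_codim_1_iff_decomp[OF linear_space_J
        submodule_vimage[OF carrier_is_submodule]] by blast
qed

text \<open>In coordinates the derived algebra is 0 \<times> S with S = k v + Im f. It lies in 0
  \<times> V, which has codimension 1 already, so it has codimension 1 exactly when S is all of
  V.\<close>

lemma derived_codim_iff:
  "has_codim K J (derived_algebra K J) 1 \<longleftrightarrow>
    carrier V = {a \<odot>\<^sub>V v \<oplus>\<^sub>V f x | a x. a \<in> carrier K \<and> x \<in> carrier V}" (is "_ \<longleftrightarrow> _ = ?S")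
proof
  assume "carrier V = ?S"
  then show "has_codim K J (derived_algebra K J) 1"
    using vimage_codim unfolding derived_eq by simp
next
  assume "has_codim K J (derived_algebra K J) 1"
  then obtain e where e: "e \<in> carrier J"
    and decomp: "\<And>z. z \<in> carrier J \<Longrightarrow>
      \<exists>a\<in>carrier K. \<exists>y\<in>{z \<in> carrier J. h z \<in> {\<zero>} \<times> ?S}. z = y \<oplus>\<^bsub>J\<^esub> a \<odot>\<^bsub>J\<^esub> e"
    unfolding derived_eq linear_space.has_codim_1_iff_decomp[OF linear_space_J
        submodule_vimage[OF submodule_sum]] by blast
  obtain q w where q: "h e = (q, w)" "q \<in> carrier K" "w \<in> carrier V" using h_cases[OF e] .
  have coord: "\<exists>a\<in>carrier K. \<exists>s\<in>?S. p = a \<otimes> q \<and> x = s \<oplus>\<^sub>V a \<odot>\<^sub>V w"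
    if px: "p \<in> carrier K" "x \<in> carrier V" for p x
  proof -
    obtain z where z: "z \<in> carrier J" "h z = (p, x)" using h_surj[OF px] .
    obtain a y s where ay: "a \<in> carrier K" "y \<in> carrier J" "h y = (\<zero>, s)" "s \<in> ?S"
      "z = y \<oplus>\<^bsub>J\<^esub> a \<odot>\<^bsub>J\<^esub> e"
      using decomp[OF z(1)] by blast
    then have "h z = (\<zero> \<oplus> a \<otimes> q, s \<oplus>\<^sub>V a \<odot>\<^sub>V w)"
      using q e by (simp add: h_add h_smult)
    then have "p = a \<otimes> q" "x = s \<oplus>\<^sub>V a \<odot>\<^sub>V w" using z(2) ay(1) q(2) by simp_all
    then show ?thesis using ay(1,4) by blast
  qed
  \<comment> \<open>Some vector has first coordinate 1, and this must be a multiple of q.\<close>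
  have "q \<noteq> \<zero>" using coord[OF one_closed M.zero_closed] by auto
  have "carrier V \<subseteq> ?S"
  proof
    fix x assume "x \<in> carrier V"
    then obtain a s where as: "a \<in> carrier K" "s \<in> ?S" "\<zero> = a \<otimes> q" "x = s \<oplus>\<^sub>V a \<odot>\<^sub>V w"
      using coord[OF R.zero_closed] by blast
    \<comment> \<open>A vector with first coordinate 0 involves no multiple of e, so its second
      coordinate is already in S.\<close>
    then have "a = \<zero>" using \<open>q \<noteq> \<zero>\<close> q integral by metis
    moreover have "s \<in> carrier V" using as(2) by (auto simp: v_closed f_closed)
    ultimately have "x = s" using as(4) q(3) by simp
    then show "x \<in> ?S" using as(2) by simp
  qed
  then show "carrier V = ?S" by (auto simp: v_closed f_closed)
qed

end

section \<open>The two directions of the classification\<close>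

lemma jj_isomorphic_pair_algebra:
  assumes "field K" "jj_algebra K J" "module K V" and nz: "(f, v) \<in> nonzero_pairs K V"
    and "jj_isomorphic K J (pair_algebra K V f v)"
  shows "\<not> abelian_algebra J" "abelian_algebra (J\<lparr>carrier := derived_algebra K J\<rparr>)"
    and "\<exists>I. submodule I K J \<and> derived_algebra K J \<subseteq> I \<and>
      abelian_algebra (J\<lparr>carrier := I\<rparr>) \<and> has_codim K J I 1"
    and "has_codim K J (derived_algebra K J) 1 \<longleftrightarrow>
      carrier V = {a \<odot>\<^bsub>V\<^esub> v \<oplus>\<^bsub>V\<^esub> f x | a x. a \<in> carrier K \<and> x \<in> carrier V}"
proof -
  obtain h where h: "linear_map K J (pair_algebra K V f v) h"
    "bij_betw h (carrier J) (carrier (pair_algebra K V f v))"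
    "\<forall>x\<in>carrier J. \<forall>y\<in>carrier J. h (x \<otimes>\<^bsub>J\<^esub> y) = h x \<otimes>\<^bsub>pair_algebra K V f v\<^esub> h y"
    using assms(5) unfolding jj_isomorphic_def by blast
  interpret linear_space K V by (intro linear_space.intro assms)
  interpret jj_pair_iso K V J f v h
    using h nz by (intro jj_pair_iso.intro jj_pair_iso_axioms.intro linear_space_axioms assms)
      (auto simp: nonzero_pairs_def)
  show "\<not> abelian_algebra J" using nz by (simp add: abelian_iff nonzero_pairs_def)
  show "abelian_algebra (J\<lparr>carrier := derived_algebra K J\<rparr>)" by (rule derived_abelian)
  show "\<exists>I. submodule I K J \<and> derived_algebra K J \<subseteq> I \<and>
      abelian_algebra (J\<lparr>carrier := I\<rparr>) \<and> has_codim K J I 1"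
    using submodule_vimage[OF carrier_is_submodule] derived_subset_vimage vimage_abelian vimage_codim
    by blast
  show "has_codim K J (derived_algebra K J) 1 \<longleftrightarrow>
      carrier V = {a \<odot>\<^bsub>V\<^esub> v \<oplus>\<^bsub>V\<^esub> f x | a x. a \<in> carrier K \<and> x \<in> carrier V}"
    by (rule derived_codim_iff)
qed

text \<open>The space V is \<open>I\<close> itself with the operations of \<open>J\<close>, so its
  vectors have the type of those of \<open>J\<close>. The pair consists of multiplication by a
  complementary vector e, restricted to \<open>I\<close>, and of e e.\<close>

lemma ex_pair_algebra:
  fixes K :: "('k, 'm) ring_scheme" and J :: "('k, 'j) module"
  assumes "field K" "jj_algebra K J"
    and char: "add_pow K (2::nat) \<one>\<^bsub>K\<^esub> \<noteq> \<zero>\<^bsub>K\<^esub>" "add_pow K (3::nat) \<one>\<^bsub>K\<^esub> \<noteq> \<zero>\<^bsub>K\<^esub>"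
    and I: "submodule I K J" "derived_algebra K J \<subseteq> I"
    and abI: "abelian_algebra (J\<lparr>carrier := I\<rparr>)" and codim: "has_codim K J I 1"
    and nonab: "\<not> abelian_algebra J"
  shows "\<exists>f v\<^sub>0. module K (J\<lparr>carrier := I\<rparr>) \<and> (f, v\<^sub>0) \<in> nonzero_pairs K (J\<lparr>carrier := I\<rparr>) \<and>
    jj_isomorphic K J (pair_algebra K (J\<lparr>carrier := I\<rparr>) f v\<^sub>0)"
proof -
  interpret J: jj_algebra K J by fact
  interpret J: linear_space K J by (intro linear_space.intro assms J.module_axioms)
  let ?W = "J\<lparr>carrier := I\<rparr>"
  have W: "module K ?W" using submodule.submodule_is_module[OF I(1) J.module_axioms] .
  interpret W: linear_space K ?W by (intro linear_space.intro assms W)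
  note IE = J.submoduleE[OF I(1)]
  have IJ: "x \<in> carrier J" if "x \<in> I" for x using IE(1) that by blast
  \<comment> \<open>All products lie in the derived algebra and hence in \<open>I\<close>; this
    makes e x and e e elements of the space on which the pair is defined.\<close>
  have mI: "x \<otimes>\<^bsub>J\<^esub> y \<in> I" if "x \<in> carrier J" "y \<in> carrier J" for x y
    using J.mult_in_derived[OF that] I(2) by blast
  have I0: "x \<otimes>\<^bsub>J\<^esub> y = \<zero>\<^bsub>J\<^esub>" if "x \<in> I" "y \<in> I" for x y
    using abI that by (simp add: abelian_algebra_def)
  obtain e where e: "e \<in> carrier J" "e \<notin> I"
    and decomp: "\<And>z. z \<in> carrier J \<Longrightarrow> \<exists>a\<in>carrier K. \<exists>y\<in>I. z = y \<oplus>\<^bsub>J\<^esub> a \<odot>\<^bsub>J\<^esub> e"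
    using codim unfolding J.has_codim_1_iff_decomp[OF I(1)] by blast
  define f where "f = (\<lambda>x\<in>I. e \<otimes>\<^bsub>J\<^esub> x)"
  define v where "v = e \<otimes>\<^bsub>J\<^esub> e"
  have fI: "f x = e \<otimes>\<^bsub>J\<^esub> x" if "x \<in> I" for x using that by (simp add: f_def)
  have vI: "v \<in> I" using mI e by (simp add: v_def)
  have lin: "linear_map K ?W ?W f"
    by (auto simp: linear_map_def fI mI e IJ IE J.mult_add_right J.mult_smult_right)
  have "f \<in> extensional I" by (simp add: f_def)
  with lin have "f \<in> Lin K ?W ?W" by (auto simp: Lin_def PiE_def linear_map_def)
  moreover have "f (f x) = \<zero>\<^bsub>J\<^esub>" if x: "x \<in> I" for x
  proof (rule J.double_eq_zero[OF char(1)])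
    \<comment> \<open>The summands are e (e x), e (x e) and x (e e). The last one is a product of
      two elements of the abelian \<open>I\<close>, the others are both f (f x).\<close>
    note J.jacobi[OF e(1) e(1) IJ[OF x]]
    moreover have "x \<otimes>\<^bsub>J\<^esub> (e \<otimes>\<^bsub>J\<^esub> e) = \<zero>\<^bsub>J\<^esub>" using I0 x mI e by simp
    moreover have "x \<otimes>\<^bsub>J\<^esub> e = e \<otimes>\<^bsub>J\<^esub> x" using J.mult_comm x e IJ by simp
    ultimately show "f (f x) \<oplus>\<^bsub>J\<^esub> f (f x) = \<zero>\<^bsub>J\<^esub>"
      using x e by (simp add: fI mI IJ J.mult_closed)
  qed (use x e in \<open>simp add: fI mI IJ\<close>)
  ultimately have f: "f \<in> sqzero_End K ?W" by (simp add: sqzero_End_def)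
  have "f v = \<zero>\<^bsub>J\<^esub>"
  proof (rule J.triple_eq_zero[OF char(2)])
    \<comment> \<open>At (e, e, e) all three summands of the Jacobi identity are e (e e) = f
      v.\<close>
    show "f v \<oplus>\<^bsub>J\<^esub> f v \<oplus>\<^bsub>J\<^esub> f v = \<zero>\<^bsub>J\<^esub>"
      using J.jacobi[OF e(1) e(1) e(1)] vI by (simp add: fI) (simp add: v_def)
  qed (use vI e in \<open>simp add: fI mI IJ\<close>)
  then have v: "v \<in> Ker ?W f" using vI by (simp add: Ker_iff)
  let ?P = "pair_algebra K ?W f v"
  have jjP: "jj_algebra K ?P" using W.jj_pair_algebra[OF f v] .
  \<comment> \<open>The isomorphism is built from the pair algebra to \<open>J\<close>, where the
    decomposition of \<open>J\<close> into \<open>I\<close> and k e makes it explicit; it is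
    inverted at the end.\<close>
  define g where "g = (\<lambda>(p, x). x \<oplus>\<^bsub>J\<^esub> p \<odot>\<^bsub>J\<^esub> e)"
  have g: "g (p, x) = x \<oplus>\<^bsub>J\<^esub> p \<odot>\<^bsub>J\<^esub> e" for p x by (simp add: g_def)
  have g_add: "g (p \<oplus>\<^bsub>K\<^esub> q, x \<oplus>\<^bsub>J\<^esub> y) = g (p, x) \<oplus>\<^bsub>J\<^esub> g (q, y)"
    if "p \<in> carrier K" "q \<in> carrier K" "x \<in> I" "y \<in> I" for p q x y
  proof -
    have "x \<in> carrier J" "y \<in> carrier J" using that IJ by auto
    with that e show ?thesis by (simp add: g J.smult_l_distr J.M.a_ac)
  qed
  have g_smult: "g (c \<otimes>\<^bsub>K\<^esub> p, c \<odot>\<^bsub>J\<^esub> x) = c \<odot>\<^bsub>J\<^esub> g (p, x)"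
    if "c \<in> carrier K" "p \<in> carrier K" "x \<in> I" for c p x
    using that e by (simp add: g IJ J.smult_r_distr J.smult_assoc1)
  have "linear_map K ?P J g"
    unfolding linear_map_def using g_add g_smult e IJ by (auto simp: g)
  moreover have "bij_betw g (carrier ?P) (carrier J)"
  proof (intro bij_betw_imageI)
    have "p = q \<and> x = y"
      if pq: "p \<in> carrier K" "q \<in> carrier K" and xy: "x \<in> I" "y \<in> I"
        and eq: "g (p, x) = g (q, y)" for p q x y
    proof -
      have xyJ: "x \<in> carrier J" "y \<in> carrier J" using xy IJ by auto
      \<comment> \<open>From x + p e = y + q e, the vector (p - q) e = y - x lies in
        \<open>I\<close>. A nonzero p - q would put e into \<open>I\<close>.\<close>
      have "(p \<ominus>\<^bsub>K\<^esub> q) \<odot>\<^bsub>J\<^esub> e = y \<oplus>\<^bsub>J\<^esub> \<ominus>\<^bsub>J\<^esub> x"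
      proof -
        have "(p \<ominus>\<^bsub>K\<^esub> q) \<odot>\<^bsub>J\<^esub> e = p \<odot>\<^bsub>J\<^esub> e \<oplus>\<^bsub>J\<^esub> \<ominus>\<^bsub>J\<^esub> (q \<odot>\<^bsub>J\<^esub> e)"
          using pq e by (simp add: a_minus_def J.smult_l_distr J.smult_l_minus)
        also have "p \<odot>\<^bsub>J\<^esub> e = \<ominus>\<^bsub>J\<^esub> x \<oplus>\<^bsub>J\<^esub> (x \<oplus>\<^bsub>J\<^esub> p \<odot>\<^bsub>J\<^esub> e)"
          using pq e xyJ by (simp add: J.M.r_neg1)
        also have "x \<oplus>\<^bsub>J\<^esub> p \<odot>\<^bsub>J\<^esub> e = y \<oplus>\<^bsub>J\<^esub> q \<odot>\<^bsub>J\<^esub> e" using eq by (simp add: g)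
        also have "\<ominus>\<^bsub>J\<^esub> x \<oplus>\<^bsub>J\<^esub> (y \<oplus>\<^bsub>J\<^esub> q \<odot>\<^bsub>J\<^esub> e) \<oplus>\<^bsub>J\<^esub> \<ominus>\<^bsub>J\<^esub> (q \<odot>\<^bsub>J\<^esub> e) = y \<oplus>\<^bsub>J\<^esub> \<ominus>\<^bsub>J\<^esub> x"
          using pq e xyJ by (simp add: J.M.a_assoc J.M.r_neg) (simp add: J.M.a_comm)
        finally show ?thesis .
      qed
      then have mem: "(p \<ominus>\<^bsub>K\<^esub> q) \<odot>\<^bsub>J\<^esub> e \<in> I" using xy IE(3,5) by simp
      have "p = q"
      proof (rule ccontr)
        assume "p \<noteq> q"
        then have u: "p \<ominus>\<^bsub>K\<^esub> q \<in> Units K" using pq by (simp add: J.field_Units)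
        then have "inv\<^bsub>K\<^esub> (p \<ominus>\<^bsub>K\<^esub> q) \<odot>\<^bsub>J\<^esub> ((p \<ominus>\<^bsub>K\<^esub> q) \<odot>\<^bsub>J\<^esub> e) \<in> I" using IE(4) mem by simp
        then show False using u e pq by (simp flip: J.smult_assoc1)
      qed
      moreover from this have "x = y" using eq pq e xyJ by (simp add: g)
      ultimately show ?thesis by simp
    qed
    then show "inj_on g (carrier ?P)" by (auto intro!: inj_onI)
    show "g ` carrier ?P = carrier J"
    proof
      show "g ` carrier ?P \<subseteq> carrier J" using e IJ by (auto simp: g)
      show "carrier J \<subseteq> g ` carrier ?P"
      proof
        fix z assume "z \<in> carrier J"
        then obtain a y where "a \<in> carrier K" "y \<in> I" "z = g (a, y)"
          using decomp unfolding g by blast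
        then show "z \<in> g ` carrier ?P" by simp
      qed
    qed
  qed
  moreover have "g ((p, x) \<otimes>\<^bsub>?P\<^esub> (q, y)) = g (p, x) \<otimes>\<^bsub>J\<^esub> g (q, y)"
    if pq: "p \<in> carrier K" "q \<in> carrier K" and xy: "x \<in> I" "y \<in> I" for p q x y
  proof -
    have xyJ: "x \<in> carrier J" "y \<in> carrier J" using xy IJ by auto
    have c: "e \<otimes>\<^bsub>J\<^esub> x \<in> carrier J" "e \<otimes>\<^bsub>J\<^esub> y \<in> carrier J" "e \<otimes>\<^bsub>J\<^esub> e \<in> carrier J"
      using J.mult_closed e xyJ by auto
    \<comment> \<open>Bilinear expansion of (x + p e) (y + q e). The term x y vanishes because
      \<open>I\<close> is abelian, and commutativity brings the rest into the form of the product of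
      pairs.\<close>
    have "g (p, x) \<otimes>\<^bsub>J\<^esub> g (q, y) =
        x \<otimes>\<^bsub>J\<^esub> y \<oplus>\<^bsub>J\<^esub> p \<odot>\<^bsub>J\<^esub> (e \<otimes>\<^bsub>J\<^esub> y) \<oplus>\<^bsub>J\<^esub> (q \<odot>\<^bsub>J\<^esub> (x \<otimes>\<^bsub>J\<^esub> e) \<oplus>\<^bsub>J\<^esub> q \<odot>\<^bsub>J\<^esub> (p \<odot>\<^bsub>J\<^esub> (e \<otimes>\<^bsub>J\<^esub> e)))"
      using pq xyJ e
      by (simp add: g J.mult_add_left J.mult_add_right J.mult_smult_left J.mult_smult_right
          J.mult_closed J.smult_r_distr)
    also have "\<dots> = (p \<otimes>\<^bsub>K\<^esub> q) \<odot>\<^bsub>J\<^esub> (e \<otimes>\<^bsub>J\<^esub> e) \<oplus>\<^bsub>J\<^esub> p \<odot>\<^bsub>J\<^esub> (e \<otimes>\<^bsub>J\<^esub> y) \<oplus>\<^bsub>J\<^esub> q \<odot>\<^bsub>J\<^esub> (e \<otimes>\<^bsub>J\<^esub> x)"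
      using pq c I0[OF xy] J.mult_comm[OF xyJ(1) e(1)]
      by (simp add: J.m_comm[of p q] J.smult_assoc1 J.M.a_ac)
    also have "\<dots> = g ((p, x) \<otimes>\<^bsub>?P\<^esub> (q, y))"
      using pq xy c e by (simp add: pair_algebra_mult g fI v_def)
    finally show ?thesis by simp
  qed
  ultimately have "jj_isomorphic K ?P J"
    unfolding jj_isomorphic_def by (intro exI[of _ g]) auto
  then have iso: "jj_isomorphic K J ?P" using jj_isomorphic_sym jjP by blast
  then obtain h where h: "linear_map K J ?P h" "bij_betw h (carrier J) (carrier ?P)"
    "\<forall>x\<in>carrier J. \<forall>y\<in>carrier J. h (x \<otimes>\<^bsub>J\<^esub> y) = h x \<otimes>\<^bsub>?P\<^esub> h y"
    unfolding jj_isomorphic_def by blast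
  \<comment> \<open>In these coordinates \<open>abelian_iff\<close> translates non-commuting with
    zero, that is a nonzero product somewhere in \<open>J\<close>, into (f, v) being different from
    (0, 0).\<close>
  interpret jj_pair_iso K ?W J f v h
    using h f v by (intro jj_pair_iso.intro jj_pair_iso_axioms.intro W.linear_space_axioms assms) auto
  have "(f, v) \<in> nonzero_pairs K ?W"
    using nonab f v unfolding abelian_iff by (simp add: nonzero_pairs_def)
  with W iso show ?thesis by blast
qed

text \<open>The derived algebra of a pair algebra is 0 \<times> (k v + Im f), which can be smaller
  than 0 \<times> V: for f = 0 and dim V = 2 its codimension is at least 2. Codimension 1 of the
  derived algebra itself thus singles out the pairs with V = k v + Im f, while all nonzero pairs
  correspond to an abelian subspace of codimension 1 that contains it. Non-abelianness matches (f,
  v) \<noteq> (0, 0): the one-dimensional algebra with zero product has a derived algebra of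
  codimension 1, but it arises from V = 0 and the zero pair. In the equivalences W has the vector
  type of \<open>J\<close>; the clause on \<open>V\<close> covers spaces of any other type.\<close>

theorem proposition3p16:
  fixes K :: "'k ring" and J :: "('k, 'j) module" and V :: "('k, 'v) module"
  assumes field: "field K"
    and char_not_2: "add_pow K (2::nat) \<one>\<^bsub>K\<^esub> \<noteq> \<zero>\<^bsub>K\<^esub>"
    and char_not_3: "add_pow K (3::nat) \<one>\<^bsub>K\<^esub> \<noteq> \<zero>\<^bsub>K\<^esub>"
  shows
    "(jj_algebra K J \<longrightarrow>
        ((\<not> abelian_algebra J \<and>
          abelian_algebra (J\<lparr>carrier := derived_algebra K J\<rparr>) \<and>
          has_codim K J (derived_algebra K J) 1)
         \<longleftrightarrow>
         (\<exists>(W :: ('k, 'j) module) f v\<^sub>0. module K W \<and> (f, v\<^sub>0) \<in> nonzero_pairs K W \<and>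
            carrier W = {a \<odot>\<^bsub>W\<^esub> v\<^sub>0 \<oplus>\<^bsub>W\<^esub> f x | a x. a \<in> carrier K \<and> x \<in> carrier W} \<and>
            jj_isomorphic K J (pair_algebra K W f v\<^sub>0)))
        \<and>
        ((\<not> abelian_algebra J \<and>
          (\<exists>I. submodule I K J \<and> derived_algebra K J \<subseteq> I \<and>
             abelian_algebra (J\<lparr>carrier := I\<rparr>) \<and> has_codim K J I 1))
         \<longleftrightarrow>
         (\<exists>(W :: ('k, 'j) module) f v\<^sub>0. module K W \<and> (f, v\<^sub>0) \<in> nonzero_pairs K W \<and>
            jj_isomorphic K J (pair_algebra K W f v\<^sub>0)))
        \<and>
        (\<forall>f v\<^sub>0. module K V \<and> (f, v\<^sub>0) \<in> nonzero_pairs K V \<and>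
           jj_isomorphic K J (pair_algebra K V f v\<^sub>0) \<longrightarrow>
           \<not> abelian_algebra J \<and>
           abelian_algebra (J\<lparr>carrier := derived_algebra K J\<rparr>) \<and>
           (\<exists>I. submodule I K J \<and> derived_algebra K J \<subseteq> I \<and>
              abelian_algebra (J\<lparr>carrier := I\<rparr>) \<and> has_codim K J I 1) \<and>
           (has_codim K J (derived_algebra K J) 1 \<longleftrightarrow>
              carrier V = {a \<odot>\<^bsub>V\<^esub> v\<^sub>0 \<oplus>\<^bsub>V\<^esub> f x | a x. a \<in> carrier K \<and> x \<in> carrier V})))
     \<and>
     (module K V \<longrightarrow>
        (\<exists>\<Phi>. bij_betw \<Phi> (SIGMA f : sqzero_End K V. Ker_mod_Im V f) (H2 K V) \<and>
          (\<forall>f \<in> sqzero_End K V. \<forall>v\<^sub>0 \<in> Ker V f.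
             \<Phi> (f, (f ` carrier V) +>\<^bsub>V\<^esub> v\<^sub>0) =
               cohomologous K V `` {(pair_act K V f, pair_cocycle K V v\<^sub>0)})))"
proof (intro conjI impI allI)
  assume jj: "jj_algebra K J"
  note props = jj_isomorphic_pair_algebra[OF field jj]
    and ex = ex_pair_algebra[OF field jj char_not_2 char_not_3]
  let ?D = "derived_algebra K J"
  show "(\<not> abelian_algebra J \<and> abelian_algebra (J\<lparr>carrier := ?D\<rparr>) \<and> has_codim K J ?D 1) \<longleftrightarrow>
    (\<exists>(W :: ('k, 'j) module) f v\<^sub>0. module K W \<and> (f, v\<^sub>0) \<in> nonzero_pairs K W \<and>
      carrier W = {a \<odot>\<^bsub>W\<^esub> v\<^sub>0 \<oplus>\<^bsub>W\<^esub> f x | a x. a \<in> carrier K \<and> x \<in> carrier W} \<and>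
      jj_isomorphic K J (pair_algebra K W f v\<^sub>0))" (is "?A \<longleftrightarrow> ?B")
  proof
    assume A: ?A
    interpret J: jj_algebra K J by fact
    \<comment> \<open>The derived algebra itself takes the place of \<open>I\<close>; its
      codimension 1 then gives W = k v + Im f through \<open>props(4)\<close>.\<close>
    obtain f v where fv: "module K (J\<lparr>carrier := ?D\<rparr>)"
      "(f, v) \<in> nonzero_pairs K (J\<lparr>carrier := ?D\<rparr>)"
      "jj_isomorphic K J (pair_algebra K (J\<lparr>carrier := ?D\<rparr>) f v)"
      using ex[OF J.submodule_derived subset_refl] A by blast
    with props(4)[OF fv] A show ?B by blast
  next
    assume ?B
    then obtain W :: "('k, 'j) module" and f v where W: "module K W" "(f, v) \<in> nonzero_pairs K W"
      and sum: "carrier W = {a \<odot>\<^bsub>W\<^esub> v \<oplus>\<^bsub>W\<^esub> f x | a x. a \<in> carrier K \<and> x \<in> carrier W}"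
      and iso: "jj_isomorphic K J (pair_algebra K W f v)" by (elim conjE exE)
    show ?A using props(1,2)[OF W iso] iffD2[OF props(4)[OF W iso] sum] by (intro conjI)
  qed
  show "(\<not> abelian_algebra J \<and> (\<exists>I. submodule I K J \<and> ?D \<subseteq> I \<and>
      abelian_algebra (J\<lparr>carrier := I\<rparr>) \<and> has_codim K J I 1)) \<longleftrightarrow>
    (\<exists>(W :: ('k, 'j) module) f v\<^sub>0. module K W \<and> (f, v\<^sub>0) \<in> nonzero_pairs K W \<and>
      jj_isomorphic K J (pair_algebra K W f v\<^sub>0))" (is "?A \<longleftrightarrow> ?B")
  proof
    assume ?A
    then obtain I where I: "submodule I K J" "?D \<subseteq> I" "abelian_algebra (J\<lparr>carrier := I\<rparr>)"
      "has_codim K J I 1" "\<not> abelian_algebra J" by (elim conjE exE)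
    show ?B by (rule exI) (rule ex[OF I])
  next
    assume ?B
    then obtain W :: "('k, 'j) module" and f v where W: "module K W" "(f, v) \<in> nonzero_pairs K W"
      "jj_isomorphic K J (pair_algebra K W f v)" by (elim conjE exE)
    show ?A using props(1,3)[OF W] by (rule conjI)
  qed
next
  fix f v\<^sub>0
  assume "jj_algebra K J" "module K V \<and> (f, v\<^sub>0) \<in> nonzero_pairs K V \<and>
    jj_isomorphic K J (pair_algebra K V f v\<^sub>0)"
  then have hyps: "jj_algebra K J" "module K V" "(f, v\<^sub>0) \<in> nonzero_pairs K V"
    "jj_isomorphic K J (pair_algebra K V f v\<^sub>0)" by auto
  note props = jj_isomorphic_pair_algebra[OF field hyps]
  show "\<not> abelian_algebra J" by (rule props)
  show "abelian_algebra (J\<lparr>carrier := derived_algebra K J\<rparr>)" by (rule props)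
  show "\<exists>I. submodule I K J \<and> derived_algebra K J \<subseteq> I \<and>
    abelian_algebra (J\<lparr>carrier := I\<rparr>) \<and> has_codim K J I 1" by (rule props)
  show "has_codim K J (derived_algebra K J) 1 \<longleftrightarrow>
    carrier V = {a \<odot>\<^bsub>V\<^esub> v\<^sub>0 \<oplus>\<^bsub>V\<^esub> f x | a x. a \<in> carrier K \<and> x \<in> carrier V}" by (rule props)
next
  assume "module K V"
  then interpret linear_space K V by (intro linear_space.intro field)
  show "\<exists>\<Phi>. bij_betw \<Phi> (SIGMA f : sqzero_End K V. Ker_mod_Im V f) (H2 K V) \<and>
    (\<forall>f \<in> sqzero_End K V. \<forall>v\<^sub>0 \<in> Ker V f. \<Phi> (f, (f ` carrier V) +>\<^bsub>V\<^esub> v\<^sub>0) =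
      cohomologous K V `` {(pair_act K V f, pair_cocycle K V v\<^sub>0)})"
    by (rule H2_bij[OF char_not_2 char_not_3])
qed

end
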